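(* Let $(X,\mathcal{O}_X)$ be an $a$-space and let $\mathcal{F}$ be a sheaf of $\mathcal{O}_X$-modules. Consider the exterior algebra as a complex with zero differential, $\wedge^\bullet_{\mathcal{O}_X}\mathcal{F}:=(\oplus_i\wedge^i_{\mathcal{O}_X}\mathcal{F},0)$. Then for every integer $k\ge0$ there is a canonical isomorphism of $\mathbb{K}$-vector spaces $$\mathbb{H}^k(X,\wedge^\bullet_{\mathcal{O}_X}\mathcal{F})\cong\bigoplus_{i+j=k}H^j(X,\wedge^i_{\mathcal{O}_X}\mathcal{F}).$$
   Context: $\mathbb{K}$ is $\mathbb{R}$, $\mathbb{C}$ or an algebraically closed field of characteristic zero. An $a$-space is a pair $(X,\mathcal{O}_X)$ with $X$ a topological space and $\mathcal{O}_X$ a sheaf of $\mathbb{K}_X$-subalgebras of the sheaf of continuous $\mathbb{K}$-valued functions on $X$ ($\mathbb{K}$ with one of its standard topologies). $\mathbb{H}^k(X,\mathcal{F}^\bullet)$ denotes the $k$-th hypercohomology of a complex of sheaves, i.e. the $k$-th cohomology of global sections of the total complex of the flabby Godement resolutions of the terms; $H^j(X,-)$ is sheaf cohomology. Here $i,j\ge0$ and $\wedge^i_{\mathcal{O}_X}\mathcal{F}$ is in degree $i$. *)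

theory Defs
  imports "HOL-Analysis.Analysis" "HOL-Algebra.Module" "HOL-Algebra.QuotRing"
    "HOL-Computational_Algebra.Polynomial"
begin

section \<open>Linear algebra over a ring\<close>

text \<open>
  Records of type \<^typ>\<open>('r, 'a) module\<close> extend \<^typ>\<open>'a ring\<close>; the multiplicative fields are
  irrelevant for modules and are left \<^const>\<open>undefined\<close> below.
\<close>

definition field_ring :: "'k::field ring"
  where "field_ring = \<lparr>carrier = UNIV, mult = (*), one = 1, zero = 0, add = (+)\<rparr>"

definition prod_module :: "'i set \<Rightarrow> ('i \<Rightarrow> ('r, 'a) module) \<Rightarrow> ('r, 'i \<Rightarrow> 'a) module"
  where "prod_module I M =
    \<lparr>carrier = (\<Pi>\<^sub>E i\<in>I. carrier (M i)), mult = undefined, one = undefined,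
     zero = (\<lambda>i\<in>I. \<zero>\<^bsub>M i\<^esub>), add = (\<lambda>s t. \<lambda>i\<in>I. s i \<oplus>\<^bsub>M i\<^esub> t i),
     smult = (\<lambda>r s. \<lambda>i\<in>I. r \<odot>\<^bsub>M i\<^esub> s i)\<rparr>"

definition quot_module :: "('r, 'a) module \<Rightarrow> 'a set \<Rightarrow> ('r, 'a set) module"
  where "quot_module M N =
    \<lparr>carrier = a_rcosets\<^bsub>M\<^esub> N, mult = undefined, one = undefined,
     zero = N, add = (\<lambda>A B. A <+>\<^bsub>M\<^esub> B),
     smult = (\<lambda>r A. \<Union>a\<in>A. N +>\<^bsub>M\<^esub> (r \<odot>\<^bsub>M\<^esub> a))\<rparr>"

definition restrict_scalars :: "('s \<Rightarrow> 'r) \<Rightarrow> ('r, 'a) module \<Rightarrow> ('s, 'a) module"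
  where "restrict_scalars h M =
    \<lparr>carrier = carrier M, mult = undefined, one = undefined,
     zero = \<zero>\<^bsub>M\<^esub>, add = (\<oplus>\<^bsub>M\<^esub>), smult = (\<lambda>r a. h r \<odot>\<^bsub>M\<^esub> a)\<rparr>"

text \<open>Transport of structure along a map that is injective on the carrier.\<close>

definition transport_module :: "('a \<Rightarrow> 'b) \<Rightarrow> ('r, 'a) module \<Rightarrow> ('r, 'b) module"
  where "transport_module h M = (let g = inv_into (carrier M) h in
    \<lparr>carrier = h ` carrier M, mult = undefined, one = undefined,
     zero = h \<zero>\<^bsub>M\<^esub>, add = (\<lambda>a b. h (g a \<oplus>\<^bsub>M\<^esub> g b)),
     smult = (\<lambda>r a. h (r \<odot>\<^bsub>M\<^esub> g a))\<rparr>)"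

definition module_iso :: "('r, 'c) ring_scheme \<Rightarrow> ('r, 'a) module \<Rightarrow> ('r, 'b) module \<Rightarrow> ('a \<Rightarrow> 'b) set"
  where "module_iso R M N = {f. module R M \<and> module R N \<and> bij_betw f (carrier M) (carrier N) \<and>
    (\<forall>a\<in>carrier M. \<forall>b\<in>carrier M. f (a \<oplus>\<^bsub>M\<^esub> b) = f a \<oplus>\<^bsub>N\<^esub> f b) \<and>
    (\<forall>r\<in>carrier R. \<forall>a\<in>carrier M. f (r \<odot>\<^bsub>M\<^esub> a) = r \<odot>\<^bsub>N\<^esub> f a)}"

subsection \<open>Cohomology of a complex in non-negative degrees\<close>

definition cocycles :: "(nat \<Rightarrow> ('r, 'a) module) \<Rightarrow> (nat \<Rightarrow> 'a \<Rightarrow> 'a) \<Rightarrow> nat \<Rightarrow> 'a set"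
  where "cocycles C d n = {z \<in> carrier (C n). d n z = \<zero>\<^bsub>C (Suc n)\<^esub>}"

definition coboundaries :: "(nat \<Rightarrow> ('r, 'a) module) \<Rightarrow> (nat \<Rightarrow> 'a \<Rightarrow> 'a) \<Rightarrow> nat \<Rightarrow> 'a set"
  where "coboundaries C d n =
    (case n of 0 \<Rightarrow> {\<zero>\<^bsub>C 0\<^esub>} | Suc m \<Rightarrow> d m ` carrier (C m))"

definition cohomology ::
    "(nat \<Rightarrow> ('r, 'a) module) \<Rightarrow> (nat \<Rightarrow> 'a \<Rightarrow> 'a) \<Rightarrow> nat \<Rightarrow> ('r, 'a set) module"
  where "cohomology C d n = quot_module ((C n)\<lparr>carrier := cocycles C d n\<rparr>) (coboundaries C d n)"

definition cohomology_class ::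
    "(nat \<Rightarrow> ('r, 'a) module) \<Rightarrow> (nat \<Rightarrow> 'a \<Rightarrow> 'a) \<Rightarrow> nat \<Rightarrow> 'a \<Rightarrow> 'a set"
  where "cohomology_class C d n z = coboundaries C d n +>\<^bsub>C n\<^esub> z"

subsection \<open>Exterior powers\<close>

text \<open>The free module on a set \<open>B\<close>: finitely supported functions.\<close>

definition free_module :: "('r, 'c) ring_scheme \<Rightarrow> 'b set \<Rightarrow> ('r, 'b \<Rightarrow> 'r) module"
  where "free_module R B =
    \<lparr>carrier = {\<phi>. (\<forall>b. \<phi> b \<in> carrier R) \<and> {b. \<phi> b \<noteq> \<zero>\<^bsub>R\<^esub>} \<subseteq> B \<and> finite {b. \<phi> b \<noteq> \<zero>\<^bsub>R\<^esub>}},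
     mult = undefined, one = undefined,
     zero = (\<lambda>_. \<zero>\<^bsub>R\<^esub>), add = (\<lambda>\<phi> \<psi> b. \<phi> b \<oplus>\<^bsub>R\<^esub> \<psi> b),
     smult = (\<lambda>r \<phi> b. r \<otimes>\<^bsub>R\<^esub> \<phi> b)\<rparr>"

definition free_gen :: "('r, 'c) ring_scheme \<Rightarrow> 'b \<Rightarrow> 'b \<Rightarrow> 'r"
  where "free_gen R b = (\<lambda>b'. if b' = b then \<one>\<^bsub>R\<^esub> else \<zero>\<^bsub>R\<^esub>)"

definition tuples :: "nat \<Rightarrow> 'a set \<Rightarrow> 'a list set"
  where "tuples i A = {l \<in> lists A. length l = i}"

text \<open>
  The \<open>i\<close>-th exterior power of \<open>M\<close> is the free module on \<open>M\<^sup>i\<close> modulo additivity and homogeneity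
  in each slot and the vanishing of the tuples with two equal entries.
\<close>

definition exterior_generators :: "('r, 'c) ring_scheme \<Rightarrow> ('r, 'a) module \<Rightarrow> nat \<Rightarrow> ('a list \<Rightarrow> 'r) set"
  where "exterior_generators R M i =
    (let L = free_module R (tuples i (carrier M)); e = free_gen R in
     {e (us @ (a \<oplus>\<^bsub>M\<^esub> b) # vs) \<ominus>\<^bsub>L\<^esub> (e (us @ a # vs) \<oplus>\<^bsub>L\<^esub> e (us @ b # vs)) | us a b vs.
        us @ a # vs \<in> tuples i (carrier M) \<and> b \<in> carrier M} \<union>
     {e (us @ (r \<odot>\<^bsub>M\<^esub> a) # vs) \<ominus>\<^bsub>L\<^esub> r \<odot>\<^bsub>L\<^esub> e (us @ a # vs) | us r a vs.
        us @ a # vs \<in> tuples i (carrier M) \<and> r \<in> carrier R} \<union>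
     {e (us @ a # vs @ a # ws) | us a vs ws.
        us @ a # vs @ a # ws \<in> tuples i (carrier M)})"

definition exterior_relations :: "('r, 'c) ring_scheme \<Rightarrow> ('r, 'a) module \<Rightarrow> nat \<Rightarrow> ('a list \<Rightarrow> 'r) set"
  where "exterior_relations R M i =
    (\<lambda>N. submodule N R (free_module R (tuples i (carrier M)))) hull exterior_generators R M i"

section \<open>Presheaves of modules\<close>

text \<open>
  Sections and restriction maps are only meaningful on open sets; \<open>res P U V\<close> restricts from \<open>U\<close>
  to \<open>V \<subseteq> U\<close>.  The scalars may act through a different ring on each open set, which is fixed
  separately.
\<close>

record ('x, 'r, 'a) presheaf =
  sect :: "'x set \<Rightarrow> ('r, 'a) module"
  res :: "'x set \<Rightarrow> 'x set \<Rightarrow> 'a \<Rightarrow> 'a"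

definition quot_presheaf ::
    "('x, 'r, 'a) presheaf \<Rightarrow> ('x set \<Rightarrow> 'a set) \<Rightarrow> ('x, 'r, 'a set) presheaf"
  where "quot_presheaf P N =
    \<lparr>sect = (\<lambda>U. quot_module (sect P U) (N U)),
     res = (\<lambda>U V A. \<Union>a\<in>A. N V +>\<^bsub>sect P V\<^esub> res P U V a)\<rparr>"

definition transport_presheaf :: "('a \<Rightarrow> 'b) \<Rightarrow> ('x, 'r, 'a) presheaf \<Rightarrow> ('x, 'r, 'b) presheaf"
  where "transport_presheaf h P =
    \<lparr>sect = (\<lambda>U. transport_module h (sect P U)),
     res = (\<lambda>U V a. h (res P U V (inv_into (carrier (sect P U)) h a)))\<rparr>"

section \<open>\<open>a\<close>-spaces and their sheaves of modules\<close>

definition zariski_topology :: "'k::field topology"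
  where "zariski_topology = topology_generated_by (range (\<lambda>p. {x. poly p x \<noteq> 0}))"

text \<open>
  The ground field with its topology: a copy of the reals or of the complex numbers with the
  Euclidean topology, or the reals or an algebraically closed field with the Zariski topology
  of the affine line.
\<close>

definition ground_field_topology :: "'k::field_char_0 topology \<Rightarrow> bool"
  where "ground_field_topology T \<longleftrightarrow>
    (\<exists>\<phi> \<in> ring_iso (field_ring :: 'k ring) (field_ring :: real ring).
        homeomorphic_map T euclidean \<phi> \<or> T = zariski_topology) \<or>
    (\<exists>\<phi> \<in> ring_iso (field_ring :: 'k ring) (field_ring :: complex ring).
        homeomorphic_map T euclidean \<phi>) \<or>
    (\<forall>p :: 'k poly. degree p > 0 \<longrightarrow> (\<exists>x. poly p x = 0)) \<and> T = zariski_topology"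

text \<open>A function on \<open>U\<close> is represented by an extensional function, i.e. \<^const>\<open>undefined\<close> off \<open>U\<close>.\<close>

locale a_space =
  fixes X :: "'x topology" and T :: "'k::field_char_0 topology" and \<O> :: "'x set \<Rightarrow> ('x \<Rightarrow> 'k) set"
  assumes ground_field: "ground_field_topology T"
    and extensional: "openin X U \<Longrightarrow> f \<in> \<O> U \<Longrightarrow> f \<in> extensional U"
    and continuous: "openin X U \<Longrightarrow> f \<in> \<O> U \<Longrightarrow> continuous_map (subtopology X U) T f"
    and const_closed: "openin X U \<Longrightarrow> (\<lambda>x\<in>U. c) \<in> \<O> U"
    and add_closed: "openin X U \<Longrightarrow> f \<in> \<O> U \<Longrightarrow> g \<in> \<O> U \<Longrightarrow> (\<lambda>x\<in>U. f x + g x) \<in> \<O> U"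
    and mult_closed: "openin X U \<Longrightarrow> f \<in> \<O> U \<Longrightarrow> g \<in> \<O> U \<Longrightarrow> (\<lambda>x\<in>U. f x * g x) \<in> \<O> U"
    and restrict_closed: "openin X U \<Longrightarrow> openin X V \<Longrightarrow> V \<subseteq> U \<Longrightarrow> f \<in> \<O> U \<Longrightarrow> restrict f V \<in> \<O> V"
    and gluing: "(\<And>U. U \<in> \<U> \<Longrightarrow> openin X U \<and> restrict f U \<in> \<O> U) \<Longrightarrow> f \<in> extensional (\<Union>\<U>)
      \<Longrightarrow> f \<in> \<O> (\<Union>\<U>)"

definition function_ring :: "('x set \<Rightarrow> ('x \<Rightarrow> 'k::field) set) \<Rightarrow> 'x set \<Rightarrow> ('x \<Rightarrow> 'k) ring"
  where "function_ring \<O> U =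
    \<lparr>carrier = \<O> U, mult = (\<lambda>f g. \<lambda>x\<in>U. f x * g x), one = (\<lambda>x\<in>U. 1),
     zero = (\<lambda>x\<in>U. 0), add = (\<lambda>f g. \<lambda>x\<in>U. f x + g x)\<rparr>"

locale sheaf_of_modules =
  fixes X :: "'x topology" and \<O> :: "'x set \<Rightarrow> ('x \<Rightarrow> 'k::field) set"
    and F :: "('x, 'x \<Rightarrow> 'k, 'a) presheaf"
  assumes module: "openin X U \<Longrightarrow> module (function_ring \<O> U) (sect F U)"
    and res_closed: "openin X U \<Longrightarrow> openin X V \<Longrightarrow> V \<subseteq> U \<Longrightarrow> s \<in> carrier (sect F U)
      \<Longrightarrow> res F U V s \<in> carrier (sect F V)"
    and res_id: "openin X U \<Longrightarrow> s \<in> carrier (sect F U) \<Longrightarrow> res F U U s = s"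
    and res_res: "openin X U \<Longrightarrow> openin X V \<Longrightarrow> openin X W \<Longrightarrow> W \<subseteq> V \<Longrightarrow> V \<subseteq> U
      \<Longrightarrow> s \<in> carrier (sect F U) \<Longrightarrow> res F V W (res F U V s) = res F U W s"
    and res_add: "openin X U \<Longrightarrow> openin X V \<Longrightarrow> V \<subseteq> U
      \<Longrightarrow> s \<in> carrier (sect F U) \<Longrightarrow> t \<in> carrier (sect F U)
      \<Longrightarrow> res F U V (s \<oplus>\<^bsub>sect F U\<^esub> t) = res F U V s \<oplus>\<^bsub>sect F V\<^esub> res F U V t"
    and res_smult: "openin X U \<Longrightarrow> openin X V \<Longrightarrow> V \<subseteq> U \<Longrightarrow> f \<in> \<O> U \<Longrightarrow> s \<in> carrier (sect F U)
      \<Longrightarrow> res F U V (f \<odot>\<^bsub>sect F U\<^esub> s) = restrict f V \<odot>\<^bsub>sect F V\<^esub> res F U V s"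
    and locality: "(\<And>U. U \<in> \<U> \<Longrightarrow> openin X U)
      \<Longrightarrow> s \<in> carrier (sect F (\<Union>\<U>)) \<Longrightarrow> t \<in> carrier (sect F (\<Union>\<U>))
      \<Longrightarrow> (\<And>U. U \<in> \<U> \<Longrightarrow> res F (\<Union>\<U>) U s = res F (\<Union>\<U>) U t) \<Longrightarrow> s = t"
    and gluing: "(\<And>U. U \<in> \<U> \<Longrightarrow> openin X U \<and> \<sigma> U \<in> carrier (sect F U))
      \<Longrightarrow> (\<And>U V. U \<in> \<U> \<Longrightarrow> V \<in> \<U> \<Longrightarrow> res F U (U \<inter> V) (\<sigma> U) = res F V (U \<inter> V) (\<sigma> V))
      \<Longrightarrow> \<exists>s \<in> carrier (sect F (\<Union>\<U>)). \<forall>U\<in>\<U>. res F (\<Union>\<U>) U s = \<sigma> U"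

section \<open>Stalks and sheafification\<close>

text \<open>
  From here on presheaves are presheaves of vector spaces over a fixed field.  The operations on
  germs are written as unions over representatives; all the sets united coincide.
\<close>

definition germ :: "'x topology \<Rightarrow> ('x, 'k, 'a) presheaf \<Rightarrow> 'x \<Rightarrow> 'x set \<Rightarrow> 'a \<Rightarrow> ('x set \<times> 'a) set"
  where "germ X P x U s =
    {(V, t). openin X V \<and> x \<in> V \<and> t \<in> carrier (sect P V) \<and>
       (\<exists>W. openin X W \<and> x \<in> W \<and> W \<subseteq> U \<inter> V \<and> res P U W s = res P V W t)}"

definition stalk :: "'x topology \<Rightarrow> ('x, 'k, 'a) presheaf \<Rightarrow> 'x \<Rightarrow> ('k, ('x set \<times> 'a) set) module"
  where "stalk X P x =
    \<lparr>carrier = {germ X P x U s | U s. openin X U \<and> x \<in> U \<and> s \<in> carrier (sect P U)},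
     mult = undefined, one = undefined,
     zero = germ X P x (topspace X) \<zero>\<^bsub>sect P (topspace X)\<^esub>,
     add = (\<lambda>g h. \<Union>(U, s)\<in>g. \<Union>(V, t)\<in>h.
       germ X P x (U \<inter> V) (res P U (U \<inter> V) s \<oplus>\<^bsub>sect P (U \<inter> V)\<^esub> res P V (U \<inter> V) t)),
     smult = (\<lambda>r g. \<Union>(U, s)\<in>g. germ X P x U (r \<odot>\<^bsub>sect P U\<^esub> s))\<rparr>"

text \<open>The flabby sheaf of all, possibly discontinuous, families of germs.\<close>

definition godement :: "'x topology \<Rightarrow> ('x, 'k, 'a) presheaf \<Rightarrow> ('x, 'k, 'x \<Rightarrow> ('x set \<times> 'a) set) presheaf"
  where "godement X P =
    \<lparr>sect = (\<lambda>U. prod_module U (stalk X P)), res = (\<lambda>U V s. restrict s V)\<rparr>"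

definition germs :: "'x topology \<Rightarrow> ('x, 'k, 'a) presheaf \<Rightarrow> 'x set \<Rightarrow> 'a \<Rightarrow> 'x \<Rightarrow> ('x set \<times> 'a) set"
  where "germs X P U s = (\<lambda>x\<in>U. germ X P x U s)"

definition sheafify :: "'x topology \<Rightarrow> ('x, 'k, 'a) presheaf \<Rightarrow> ('x, 'k, 'x \<Rightarrow> ('x set \<times> 'a) set) presheaf"
  where "sheafify X P =
    \<lparr>sect = (\<lambda>U. (sect (godement X P) U)\<lparr>carrier :=
        {s \<in> carrier (sect (godement X P) U). \<forall>x\<in>U. \<exists>V t. openin X V \<and> x \<in> V \<and> V \<subseteq> U \<and>
           t \<in> carrier (sect P V) \<and> restrict s V = germs X P V t}\<rparr>),
     res = res (godement X P)\<rparr>"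

text \<open>
  A morphism \<open>P \<rightarrow> Q\<close> of presheaves is given by its components \<open>f U\<close>.  The following is the induced
  morphism both on the sheaves of families of germs and on the sheafifications.
\<close>

definition germs_map ::
    "'x topology \<Rightarrow> ('x, 'k, 'b) presheaf \<Rightarrow> ('x set \<Rightarrow> 'a \<Rightarrow> 'b)
      \<Rightarrow> 'x set \<Rightarrow> ('x \<Rightarrow> ('x set \<times> 'a) set) \<Rightarrow> 'x \<Rightarrow> ('x set \<times> 'b) set"
  where "germs_map X Q f U s = (\<lambda>x\<in>U. \<Union>(V, t)\<in>s x. germ X Q x V (f V t))"

section \<open>Exterior powers of a sheaf of modules\<close>

text \<open>The presheaf \<open>U \<mapsto> \<Lambda>\<^sup>i F(U)\<close> over the sheaf of rings, with restriction applied entrywise.\<close>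

definition free_presheaf ::
    "('x set \<Rightarrow> ('x \<Rightarrow> 'k::field) set) \<Rightarrow> ('x, 'x \<Rightarrow> 'k, 'a) presheaf \<Rightarrow> nat
      \<Rightarrow> ('x, 'x \<Rightarrow> 'k, 'a list \<Rightarrow> 'x \<Rightarrow> 'k) presheaf"
  where "free_presheaf \<O> F i =
    \<lparr>sect = (\<lambda>U. free_module (function_ring \<O> U) (tuples i (carrier (sect F U)))),
     res = (\<lambda>U V \<phi> m. finsum (function_ring \<O> V) (\<lambda>l. restrict (\<phi> l) V)
       {l. \<phi> l \<noteq> \<zero>\<^bsub>function_ring \<O> U\<^esub> \<and> map (res F U V) l = m})\<rparr>"

definition exterior_presheaf ::
    "('x set \<Rightarrow> ('x \<Rightarrow> 'k::field) set) \<Rightarrow> ('x, 'x \<Rightarrow> 'k, 'a) presheaf \<Rightarrow> nat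
      \<Rightarrow> ('x, 'x \<Rightarrow> 'k, ('a list \<Rightarrow> 'x \<Rightarrow> 'k) set) presheaf"
  where "exterior_presheaf \<O> F i =
    quot_presheaf (free_presheaf \<O> F i) (\<lambda>U. exterior_relations (function_ring \<O> U) (sect F U) i)"

definition underlying_vector_spaces ::
    "('x, 'x \<Rightarrow> 'k, 'a) presheaf \<Rightarrow> ('x, 'k, 'a) presheaf"
  where "underlying_vector_spaces P =
    \<lparr>sect = (\<lambda>U. restrict_scalars (\<lambda>c. \<lambda>x\<in>U. c) (sect P U)), res = res P\<rparr>"

text \<open>
  Cohomology only sees the vector space structure given by the constant functions, to which we
  pass before sheafifying.
\<close>

definition exterior_sheaf ::
    "'x topology \<Rightarrow> ('x set \<Rightarrow> ('x \<Rightarrow> 'k::field) set) \<Rightarrow> ('x, 'x \<Rightarrow> 'k, 'a) presheaf \<Rightarrow> nat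
      \<Rightarrow> ('x, 'k, 'x \<Rightarrow> ('x set \<times> ('a list \<Rightarrow> 'x \<Rightarrow> 'k) set) set) presheaf"
  where "exterior_sheaf X \<O> F i = sheafify X (underlying_vector_spaces (exterior_presheaf \<O> F i))"

section \<open>The Godement resolution\<close>

text \<open>
  The resolution of \<open>P\<close> has terms \<open>C\<^sup>n = godement Z\<^sup>n\<close> with \<open>Z\<^sup>0 = P\<close> and \<open>Z\<^sup>n\<^sup>+\<^sup>1\<close> the sheaf cokernel
  of \<open>Z\<^sup>n \<rightarrow> C\<^sup>n\<close>.
\<close>

definition godement_quot ::
    "'x topology \<Rightarrow> ('x, 'k, 'a) presheaf \<Rightarrow> ('x, 'k, ('x \<Rightarrow> ('x set \<times> 'a) set) set) presheaf"
  where "godement_quot X P = quot_presheaf (godement X P) (\<lambda>U. germs X P U ` carrier (sect P U))"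

definition godement_quot_map ::
    "'x topology \<Rightarrow> ('x, 'k, 'b) presheaf \<Rightarrow> ('x set \<Rightarrow> 'a \<Rightarrow> 'b)
      \<Rightarrow> 'x set \<Rightarrow> ('x \<Rightarrow> ('x set \<times> 'a) set) set \<Rightarrow> ('x \<Rightarrow> ('x set \<times> 'b) set) set"
  where "godement_quot_map X Q f U A =
    (\<Union>a\<in>A. germs X Q U ` carrier (sect Q U) +>\<^bsub>sect (godement X Q) U\<^esub> germs_map X Q f U a)"

text \<open>
  All \<open>Z\<^sup>n\<close> must have sections in one type, while the cokernel construction increases the type.
  Its sections are therefore encoded in the following datatype by choosing representatives of
  the equivalence classes (germs and cosets) involved.  On the sections over an open set, this
  encoding is injective because distinct classes are disjoint; the structure is transported
  along it.
\<close>

datatype ('x, 'a) code = Base 'a | Node "'x \<Rightarrow> 'x set \<times> ('x \<Rightarrow> 'x set \<times> ('x, 'a) code)"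

definition encode ::
    "('x \<Rightarrow> ('x set \<times> ('x \<Rightarrow> ('x set \<times> ('x, 'a) code) set) set) set) \<Rightarrow> ('x, 'a) code"
  where "encode s = Node (\<lambda>x. case some_elem (s x) of
    (V, A) \<Rightarrow> (V, \<lambda>y. some_elem (some_elem A y)))"

primrec resolution_Z :: "'x topology \<Rightarrow> ('x, 'k, 'a) presheaf \<Rightarrow> nat \<Rightarrow> ('x, 'k, ('x, 'a) code) presheaf"
  where
    "resolution_Z X P 0 = transport_presheaf Base P"
  | "resolution_Z X P (Suc n) =
      transport_presheaf encode (sheafify X (godement_quot X (resolution_Z X P n)))"

definition resolution ::
    "'x topology \<Rightarrow> ('x, 'k, 'a) presheaf \<Rightarrow> nat \<Rightarrow> ('x, 'k, 'x \<Rightarrow> ('x set \<times> ('x, 'a) code) set) presheaf"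
  where "resolution X P n = godement X (resolution_Z X P n)"

text \<open>The differential is the composite \<open>C\<^sup>n \<rightarrow> Z\<^sup>n\<^sup>+\<^sup>1 \<rightarrow> C\<^sup>n\<^sup>+\<^sup>1\<close>.\<close>

definition resolution_diff ::
    "'x topology \<Rightarrow> ('x, 'k, 'a) presheaf \<Rightarrow> nat \<Rightarrow> 'x set
      \<Rightarrow> ('x \<Rightarrow> ('x set \<times> ('x, 'a) code) set) \<Rightarrow> 'x \<Rightarrow> ('x set \<times> ('x, 'a) code) set"
  where "resolution_diff X P n U s =
    (let Z = resolution_Z X P n;
         A = germs X Z U ` carrier (sect Z U) +>\<^bsub>sect (resolution X P n) U\<^esub> s
     in germs X (resolution_Z X P (Suc n)) U (encode (germs X (godement_quot X Z) U A)))"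

text \<open>Functoriality of the resolution in a morphism \<open>f : P \<rightarrow> Q\<close>.\<close>

definition transport_map ::
    "('a \<Rightarrow> 'c) \<Rightarrow> ('b \<Rightarrow> 'd) \<Rightarrow> ('x, 'k, 'a) presheaf \<Rightarrow> ('x set \<Rightarrow> 'a \<Rightarrow> 'b) \<Rightarrow> 'x set \<Rightarrow> 'c \<Rightarrow> 'd"
  where "transport_map h h' P f U a = h' (f U (inv_into (carrier (sect P U)) h a))"

primrec resolution_Z_map ::
    "'x topology \<Rightarrow> ('x, 'k, 'a) presheaf \<Rightarrow> ('x, 'k, 'b) presheaf \<Rightarrow> ('x set \<Rightarrow> 'a \<Rightarrow> 'b)
      \<Rightarrow> nat \<Rightarrow> 'x set \<Rightarrow> ('x, 'a) code \<Rightarrow> ('x, 'b) code"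
  where
    "resolution_Z_map X P Q f 0 = transport_map Base Base P f"
  | "resolution_Z_map X P Q f (Suc n) =
      transport_map encode encode (sheafify X (godement_quot X (resolution_Z X P n)))
        (germs_map X (godement_quot X (resolution_Z X Q n))
          (godement_quot_map X (resolution_Z X Q n) (resolution_Z_map X P Q f n)))"

definition resolution_map ::
    "'x topology \<Rightarrow> ('x, 'k, 'a) presheaf \<Rightarrow> ('x, 'k, 'b) presheaf \<Rightarrow> ('x set \<Rightarrow> 'a \<Rightarrow> 'b)
      \<Rightarrow> nat \<Rightarrow> 'x set \<Rightarrow> ('x \<Rightarrow> ('x set \<times> ('x, 'a) code) set) \<Rightarrow> 'x \<Rightarrow> ('x set \<times> ('x, 'b) code) set"
  where "resolution_map X P Q f n = germs_map X (resolution_Z X Q n) (resolution_Z_map X P Q f n)"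

section \<open>Sheaf cohomology and hypercohomology\<close>

definition sheaf_cohomology ::
    "'x topology \<Rightarrow> ('x, 'k, 'a) presheaf \<Rightarrow> nat
      \<Rightarrow> ('k, ('x \<Rightarrow> ('x set \<times> ('x, 'a) code) set) set) module"
  where "sheaf_cohomology X P =
    cohomology (\<lambda>j. sect (resolution X P j) (topspace X)) (\<lambda>j. resolution_diff X P j (topspace X))"

definition sheaf_cocycles ::
    "'x topology \<Rightarrow> ('x, 'k, 'a) presheaf \<Rightarrow> nat \<Rightarrow> ('x \<Rightarrow> ('x set \<times> ('x, 'a) code) set) set"
  where "sheaf_cocycles X P =
    cocycles (\<lambda>j. sect (resolution X P j) (topspace X)) (\<lambda>j. resolution_diff X P j (topspace X))"

definition sheaf_class ::
    "'x topology \<Rightarrow> ('x, 'k, 'a) presheaf \<Rightarrow> nat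
      \<Rightarrow> ('x \<Rightarrow> ('x set \<times> ('x, 'a) code) set) \<Rightarrow> ('x \<Rightarrow> ('x set \<times> ('x, 'a) code) set) set"
  where "sheaf_class X P =
    cohomology_class (\<lambda>j. sect (resolution X P j) (topspace X))
      (\<lambda>j. resolution_diff X P j (topspace X))"

definition antidiagonal :: "nat \<Rightarrow> (nat \<times> nat) set"
  where "antidiagonal k = {(i, j). i + j = k}"

text \<open>
  Global sections of the total complex of the double complex \<open>C\<^sup>j(F\<^sup>i)\<close>, for a complex of sheaves
  \<open>F\<^sup>0 \<rightarrow> F\<^sup>1 \<rightarrow> \<dots>\<close> with differentials \<open>d i : F\<^sup>i \<rightarrow> F\<^sup>i\<^sup>+\<^sup>1\<close>.  Being finite, the direct sum over
  \<open>i + j = k\<close> is a product.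
\<close>

definition total_sections ::
    "'x topology \<Rightarrow> (nat \<Rightarrow> ('x, 'k, 'a) presheaf) \<Rightarrow> nat
      \<Rightarrow> ('k, nat \<times> nat \<Rightarrow> 'x \<Rightarrow> ('x set \<times> ('x, 'a) code) set) module"
  where "total_sections X F k =
    prod_module (antidiagonal k) (\<lambda>(i, j). sect (resolution X (F i) j) (topspace X))"

definition total_diff ::
    "'x topology \<Rightarrow> (nat \<Rightarrow> ('x, 'k, 'a) presheaf) \<Rightarrow> (nat \<Rightarrow> 'x set \<Rightarrow> 'a \<Rightarrow> 'a) \<Rightarrow> nat
      \<Rightarrow> (nat \<times> nat \<Rightarrow> 'x \<Rightarrow> ('x set \<times> ('x, 'a) code) set)
      \<Rightarrow> nat \<times> nat \<Rightarrow> 'x \<Rightarrow> ('x set \<times> ('x, 'a) code) set"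
  where "total_diff X F d k c = (\<lambda>(i, j)\<in>antidiagonal (Suc k).
    let G = sect (resolution X (F i) j) (topspace X);
        horizontal = (case i of 0 \<Rightarrow> \<zero>\<^bsub>G\<^esub>
          | Suc i' \<Rightarrow> resolution_map X (F i') (F i) (d i') j (topspace X) (c (i', j)));
        vertical = (case j of 0 \<Rightarrow> \<zero>\<^bsub>G\<^esub>
          | Suc j' \<Rightarrow> resolution_diff X (F i) j' (topspace X) (c (i, j')))
    in horizontal \<oplus>\<^bsub>G\<^esub> (if even i then vertical else \<ominus>\<^bsub>G\<^esub> vertical))"

definition hypercohomology ::
    "'x topology \<Rightarrow> (nat \<Rightarrow> ('x, 'k, 'a) presheaf) \<Rightarrow> (nat \<Rightarrow> 'x set \<Rightarrow> 'a \<Rightarrow> 'a) \<Rightarrow> nat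
      \<Rightarrow> ('k, (nat \<times> nat \<Rightarrow> 'x \<Rightarrow> ('x set \<times> ('x, 'a) code) set) set) module"
  where "hypercohomology X F d = cohomology (total_sections X F) (total_diff X F d)"

definition hyper_cocycles ::
    "'x topology \<Rightarrow> (nat \<Rightarrow> ('x, 'k, 'a) presheaf) \<Rightarrow> (nat \<Rightarrow> 'x set \<Rightarrow> 'a \<Rightarrow> 'a) \<Rightarrow> nat
      \<Rightarrow> (nat \<times> nat \<Rightarrow> 'x \<Rightarrow> ('x set \<times> ('x, 'a) code) set) set"
  where "hyper_cocycles X F d = cocycles (total_sections X F) (total_diff X F d)"

definition hyper_class ::
    "'x topology \<Rightarrow> (nat \<Rightarrow> ('x, 'k, 'a) presheaf) \<Rightarrow> (nat \<Rightarrow> 'x set \<Rightarrow> 'a \<Rightarrow> 'a) \<Rightarrow> nat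
      \<Rightarrow> (nat \<times> nat \<Rightarrow> 'x \<Rightarrow> ('x set \<times> ('x, 'a) code) set)
      \<Rightarrow> (nat \<times> nat \<Rightarrow> 'x \<Rightarrow> ('x set \<times> ('x, 'a) code) set) set"
  where "hyper_class X F d = cohomology_class (total_sections X F) (total_diff X F d)"

definition zero_diff :: "(nat \<Rightarrow> ('x, 'k, 'a) presheaf) \<Rightarrow> nat \<Rightarrow> 'x set \<Rightarrow> 'a \<Rightarrow> 'a"
  where "zero_diff F i U s = \<zero>\<^bsub>sect (F (Suc i)) U\<^esub>"

end

theory Submission
  imports Defs
begin

text \<open>
  When the differential of the complex \<open>\<Lambda>\<^sup>\<bullet>\<close> vanishes, so does the horizontal part of the total
  differential of the double complex \<open>C\<^sup>j(\<Lambda>\<^sup>i)\<close> of Godement resolutions. The total complex in degree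
  \<open>k\<close> is then the product over \<open>i + j = k\<close> of the complexes of global sections of the resolutions of
  \<open>\<Lambda>\<^sup>i\<close>, with differentials changed by the sign \<open>(-1)\<^sup>i\<close>. Signs affect neither kernels nor images, so the
  cocycles and the coboundaries are the products of those of the factors (\<open>hyper_cocycles_eq\<close>,
  \<open>hyper_coboundaries_eq\<close>). Finally, a quotient of a product by a product of subspaces is the product of
  the quotients (\<open>quot_prod_module_iso\<close>), by the isomorphism that sends the class of a family of cocycles
  to the family of their classes. The existence of a canonical isomorphism is thus a statement about any
  graded presheaf of vector spaces (\<open>hypercohomology_zero_diff\<close>).

  The argument needs three facts about the resolution. Its terms are vector spaces and its differentials
  are linear (\<open>module_resolution\<close>, \<open>resolution_diff_hom\<close>). This holds because every step of the construction
  produces a presheaf of vector spaces from another one, including the transport along the encoding of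
  germs and cosets by representatives, which is injective (\<open>inj_encode\<close>). Consecutive differentials compose to
  zero (\<open>resolution_diff_diff\<close>), and the zero morphism induces zero on resolutions (\<open>resolution_map_zero\<close>).

  It remains to see that \<open>\<Lambda>\<^sup>i\<close> is a presheaf of vector spaces to begin with. The exterior power over \<open>\<O> U\<close> is a
  module of formal combinations of tuples of sections modulo relations. Restricting a combination is
  semilinear and functorial, which is checked on pointwise finite sums, and it maps the generating
  relations to generating relations (\<open>res_exterior_relations\<close>).
\<close>

section \<open>Modules\<close>

definition module_hom :: "('r, 'c) ring_scheme \<Rightarrow> ('r, 'a) module \<Rightarrow> ('r, 'b) module \<Rightarrow> ('a \<Rightarrow> 'b) set"
  where "module_hom R M N = {f \<in> carrier M \<rightarrow> carrier N.
    (\<forall>a\<in>carrier M. \<forall>b\<in>carrier M. f (a \<oplus>\<^bsub>M\<^esub> b) = f a \<oplus>\<^bsub>N\<^esub> f b) \<and>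
    (\<forall>r\<in>carrier R. \<forall>a\<in>carrier M. f (r \<odot>\<^bsub>M\<^esub> a) = r \<odot>\<^bsub>N\<^esub> f a)}"

lemma module_homI:
  assumes "\<And>a. a \<in> carrier M \<Longrightarrow> f a \<in> carrier N"
    and "\<And>a b. a \<in> carrier M \<Longrightarrow> b \<in> carrier M \<Longrightarrow> f (a \<oplus>\<^bsub>M\<^esub> b) = f a \<oplus>\<^bsub>N\<^esub> f b"
    and "\<And>r a. r \<in> carrier R \<Longrightarrow> a \<in> carrier M \<Longrightarrow> f (r \<odot>\<^bsub>M\<^esub> a) = r \<odot>\<^bsub>N\<^esub> f a"
  shows "f \<in> module_hom R M N"
  using assms by (auto simp: module_hom_def)

lemma module_hom_closed: "f \<in> module_hom R M N \<Longrightarrow> a \<in> carrier M \<Longrightarrow> f a \<in> carrier N"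
  by (auto simp: module_hom_def)

lemma module_hom_add:
  "f \<in> module_hom R M N \<Longrightarrow> a \<in> carrier M \<Longrightarrow> b \<in> carrier M \<Longrightarrow> f (a \<oplus>\<^bsub>M\<^esub> b) = f a \<oplus>\<^bsub>N\<^esub> f b"
  by (auto simp: module_hom_def)

lemma module_hom_smult:
  "f \<in> module_hom R M N \<Longrightarrow> r \<in> carrier R \<Longrightarrow> a \<in> carrier M \<Longrightarrow> f (r \<odot>\<^bsub>M\<^esub> a) = r \<odot>\<^bsub>N\<^esub> f a"
  by (auto simp: module_hom_def)

lemma module_hom_compose:
  "f \<in> module_hom R M N \<Longrightarrow> g \<in> module_hom R N L \<Longrightarrow> (\<lambda>a. g (f a)) \<in> module_hom R M L"
  by (simp add: module_hom_def Pi_iff)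

lemma module_hom_zero:
  assumes "module R M" "module R N" "f \<in> module_hom R M N"
  shows "f \<zero>\<^bsub>M\<^esub> = \<zero>\<^bsub>N\<^esub>"
proof -
  interpret M: module R M by fact
  interpret N: module R N by fact
  show ?thesis
    using module_hom_smult[OF assms(3) M.R.zero_closed M.M.zero_closed]
      module_hom_closed[OF assms(3) M.M.zero_closed] by simp
qed

text \<open>
  The axioms are equations between values of \<open>f\<close>. Hence a quotient module or a module structure
  transported along a map inherits them from its source.
\<close>

lemma module_surjective_image:
  fixes f :: "'a \<Rightarrow> 'b" and N :: "('r, 'b) module"
  assumes "module R M" and f: "f \<in> module_hom R M N"
    and surj: "carrier N = f ` carrier M" and zero: "\<zero>\<^bsub>N\<^esub> = f \<zero>\<^bsub>M\<^esub>"
  shows "module R N"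
proof -
  interpret M: module R M by fact
  note [simp] = module_hom_add[OF f, symmetric] module_hom_smult[OF f, symmetric]
  show ?thesis
  proof (rule moduleI)
    show "cring R" ..
    show "abelian_group N"
    proof (rule abelian_groupI)
      fix x assume "x \<in> carrier N"
      then obtain a where a: "a \<in> carrier M" "x = f a" using surj by auto
      hence "f (\<ominus>\<^bsub>M\<^esub> a) \<oplus>\<^bsub>N\<^esub> x = \<zero>\<^bsub>N\<^esub>" by (simp add: zero M.M.l_neg)
      thus "\<exists>y\<in>carrier N. y \<oplus>\<^bsub>N\<^esub> x = \<zero>\<^bsub>N\<^esub>" using a surj by blast
    qed (auto simp: surj zero M.M.a_ac)
  qed (auto simp: surj M.smult_l_distr M.smult_r_distr M.smult_assoc1)
qed

text \<open>
  Additive inverses come for free, as multiples by \<open>\<ominus> \<one>\<close>.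
\<close>

lemma (in module) submoduleI_without_inverses:
  assumes subset: "H \<subseteq> carrier M" and zero: "\<zero>\<^bsub>M\<^esub> \<in> H"
    and add: "\<And>a b. a \<in> H \<Longrightarrow> b \<in> H \<Longrightarrow> a \<oplus>\<^bsub>M\<^esub> b \<in> H"
    and smult: "\<And>r a. r \<in> carrier R \<Longrightarrow> a \<in> H \<Longrightarrow> r \<odot>\<^bsub>M\<^esub> a \<in> H"
  shows "submodule H R M"
proof (rule submoduleI)
  fix a assume a: "a \<in> H"
  hence "\<ominus>\<^bsub>M\<^esub> a = (\<ominus> \<one>) \<odot>\<^bsub>M\<^esub> a" using subset by (auto simp: smult_l_minus)
  thus "\<ominus>\<^bsub>M\<^esub> a \<in> H" using smult a by simp
qed (use assms in auto)

lemma (in module) zero_submodule: "submodule {\<zero>\<^bsub>M\<^esub>} R M"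
  by (rule submoduleI_without_inverses) auto

lemma image_submodule:
  assumes "module R M" "module R N" "f \<in> module_hom R M N"
  shows "submodule (f ` carrier M) R N"
proof -
  interpret M: module R M by fact
  interpret N: module R N by fact
  note f = module_hom_closed[OF assms(3)] module_hom_add[OF assms(3), symmetric]
    module_hom_smult[OF assms(3), symmetric] module_hom_zero[OF assms, symmetric]
  show ?thesis by (rule N.submoduleI_without_inverses) (auto simp: f)
qed

lemma kernel_submodule:
  assumes "module R M" "module R N" "f \<in> module_hom R M N"
  shows "submodule {a \<in> carrier M. f a = \<zero>\<^bsub>N\<^esub>} R M"
proof -
  interpret M: module R M by fact
  interpret N: module R N by fact
  note f = module_hom_add[OF assms(3)] module_hom_smult[OF assms(3)] module_hom_zero[OF assms]
  show ?thesis by (rule M.submoduleI_without_inverses) (auto simp: f)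
qed

lemma module_restrict_scalars:
  assumes "module R M" "cring S" and h: "h \<in> ring_hom S R"
  shows "module S (restrict_scalars h M)"
proof -
  interpret M: module R M by fact
  interpret S: cring S by fact
  note [simp] = ring_hom_closed[OF h] ring_hom_add[OF h] ring_hom_mult[OF h] ring_hom_one[OF h]
  show ?thesis
  proof (rule moduleI)
    show "abelian_group (restrict_scalars h M)"
    proof (rule abelian_groupI)
      fix x assume "x \<in> carrier (restrict_scalars h M)"
      thus "\<exists>y\<in>carrier (restrict_scalars h M). y \<oplus>\<^bsub>restrict_scalars h M\<^esub> x = \<zero>\<^bsub>restrict_scalars h M\<^esub>"
        by (intro bexI[of _ "\<ominus>\<^bsub>M\<^esub> x"]) (auto simp: restrict_scalars_def M.M.l_neg)
    qed (auto simp: restrict_scalars_def M.M.a_ac)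
  qed (auto simp: restrict_scalars_def M.smult_l_distr M.smult_r_distr M.smult_assoc1 S.cring_axioms)
qed

lemma submodule_restrict_scalars:
  assumes "module R M" "cring S" "submodule N R M" and h: "h \<in> ring_hom S R"
  shows "submodule N S (restrict_scalars h M)"
proof -
  interpret M: module R M by fact
  interpret S: module S "restrict_scalars h M"
    by (rule module_restrict_scalars[OF assms(1,2) h])
  interpret N: submodule N R M by fact
  show ?thesis
    by (rule S.submoduleI_without_inverses)
      (use N.subset N.one_closed N.m_closed ring_hom_closed[OF h] in \<open>auto simp: restrict_scalars_def\<close>)
qed

subsection \<open>Quotients\<close>

lemma coset_carrier_update: "B +>\<^bsub>M\<lparr>carrier := A\<rparr>\<^esub> z = B +>\<^bsub>M\<^esub> z"
  by (simp add: a_r_coset_def')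

lemma (in module) abelian_subgroup_submodule:
  assumes "submodule N R M" shows "abelian_subgroup N M"
  using assms submodule.axioms(1) by (intro abelian_subgroupI3 additive_subgroup.intro) (auto simp: abelian_group_axioms)

text \<open>
  The scalar multiplication of \<^const>\<open>quot_module\<close> is a union over representatives, all of which give
  the same coset.
\<close>

lemma (in module) smult_coset:
  assumes N: "submodule N R M" and r: "r \<in> carrier R" and a: "a \<in> carrier M"
  shows "(\<Union>a\<in>N +>\<^bsub>M\<^esub> a. N +>\<^bsub>M\<^esub> (r \<odot>\<^bsub>M\<^esub> a)) = N +>\<^bsub>M\<^esub> (r \<odot>\<^bsub>M\<^esub> a)"
proof -
  interpret N: submodule N R M by fact
  interpret A: abelian_subgroup N M using N by (rule abelian_subgroup_submodule)
  have "N +>\<^bsub>M\<^esub> (r \<odot>\<^bsub>M\<^esub> b) = N +>\<^bsub>M\<^esub> (r \<odot>\<^bsub>M\<^esub> a)" if b: "b \<in> N +>\<^bsub>M\<^esub> a" for b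
  proof -
    obtain n where n: "n \<in> N" "b = n \<oplus>\<^bsub>M\<^esub> a" using b by (auto simp: a_r_coset_def')
    hence nM: "n \<in> carrier M" using A.a_subset by auto
    have "r \<odot>\<^bsub>M\<^esub> b \<in> N +>\<^bsub>M\<^esub> (r \<odot>\<^bsub>M\<^esub> a)"
      using n r a nM by (auto simp: smult_r_distr a_r_coset_def')
    thus ?thesis using a_repr_independence[OF _ _ A.a_subgroup] r a by (metis smult_closed)
  qed
  moreover have "a \<in> N +>\<^bsub>M\<^esub> a" using a by (rule A.a_rcos_self)
  ultimately show ?thesis by blast
qed

lemma carrier_quot_module: "carrier (quot_module M N) = (\<lambda>a. N +>\<^bsub>M\<^esub> a) ` carrier M"
  by (auto simp: quot_module_def A_RCOSETS_def')

lemma quot_map_hom: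
  assumes "module R M" and N: "submodule N R M"
  shows "(\<lambda>a. N +>\<^bsub>M\<^esub> a) \<in> module_hom R M (quot_module M N)"
proof -
  interpret module R M by fact
  interpret A: abelian_subgroup N M using N by (rule abelian_subgroup_submodule)
  show ?thesis
    by (rule module_homI) (auto simp: carrier_quot_module, auto simp: quot_module_def A.a_rcos_sum smult_coset[OF N])
qed

lemma (in module) zero_coset:
  assumes N: "submodule N R M" and a: "a \<in> carrier M"
  shows "N +>\<^bsub>M\<^esub> a = N \<longleftrightarrow> a \<in> N"
proof -
  interpret A: abelian_subgroup N M using N by (rule abelian_subgroup_submodule)
  show ?thesis using a a_coset_join1[OF _ a A.a_subgroup] a_coset_join2[OF a A.a_subgroup] by auto
qed

lemma (in module) coset_eqI:
  assumes N: "submodule N R M" and a: "a \<in> carrier M" and b: "b \<in> N +>\<^bsub>M\<^esub> a"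
  shows "N +>\<^bsub>M\<^esub> b = N +>\<^bsub>M\<^esub> a"
proof -
  interpret A: abelian_subgroup N M using N by (rule abelian_subgroup_submodule)
  show ?thesis using a_repr_independence[OF b a A.a_subgroup] by simp
qed

lemma module_quot_module:
  assumes M: "module R M" and N: "submodule N R M"
  shows "module R (quot_module M N)"
proof (rule module_surjective_image[OF M quot_map_hom[OF M N] carrier_quot_module])
  interpret module R M by fact
  have "\<zero>\<^bsub>M\<^esub> \<in> N" using submodule.axioms(1)[OF N] subgroup.one_closed by fastforce
  thus "\<zero>\<^bsub>quot_module M N\<^esub> = N +>\<^bsub>M\<^esub> \<zero>\<^bsub>M\<^esub>"
    using zero_coset[OF N M.zero_closed] by (simp add: quot_module_def)
qed

text \<open>
  The restriction maps of a quotient presheaf have this form: a union over the representatives of a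
  coset, whose terms agree because two representatives differ by an element of \<open>N\<close>, which \<open>f\<close> maps
  into \<open>N'\<close>.
\<close>

lemma quot_union_hom:
  assumes M: "module R M" "module R M'" and N: "submodule N R M" "submodule N' R M'"
    and f: "f \<in> module_hom R M M'" and fN: "f ` N \<subseteq> N'"
  shows "a \<in> carrier M \<Longrightarrow> (\<Union>b\<in>N +>\<^bsub>M\<^esub> a. N' +>\<^bsub>M'\<^esub> f b) = N' +>\<^bsub>M'\<^esub> f a"
    and "(\<lambda>A. \<Union>b\<in>A. N' +>\<^bsub>M'\<^esub> f b) \<in> module_hom R (quot_module M N) (quot_module M' N')"
proof -
  interpret M: module R M by fact
  interpret M': module R M' by fact
  interpret A: abelian_subgroup N M using N(1) by (rule M.abelian_subgroup_submodule)
  have *: "(\<Union>b\<in>N +>\<^bsub>M\<^esub> a. N' +>\<^bsub>M'\<^esub> f b) = N' +>\<^bsub>M'\<^esub> f a" if a: "a \<in> carrier M" for a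
  proof -
    have "N' +>\<^bsub>M'\<^esub> f b = N' +>\<^bsub>M'\<^esub> f a" if b: "b \<in> N +>\<^bsub>M\<^esub> a" for b
    proof -
      obtain n where n: "n \<in> N" "b = n \<oplus>\<^bsub>M\<^esub> a" using b by (auto simp: a_r_coset_def')
      hence nM: "n \<in> carrier M" using A.a_subset by auto
      have "f b \<in> N' +>\<^bsub>M'\<^esub> f a"
        using n a nM fN by (auto simp: module_hom_add[OF f] a_r_coset_def')
      thus ?thesis by (rule M'.coset_eqI[OF N(2) module_hom_closed[OF f a]])
    qed
    moreover have "a \<in> N +>\<^bsub>M\<^esub> a" using a by (rule A.a_rcos_self)
    ultimately show ?thesis by blast
  qed
  thus "a \<in> carrier M \<Longrightarrow> (\<Union>b\<in>N +>\<^bsub>M\<^esub> a. N' +>\<^bsub>M'\<^esub> f b) = N' +>\<^bsub>M'\<^esub> f a" .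
  note q = quot_map_hom[OF M(1) N(1)] and q' = quot_map_hom[OF M(2) N(2)]
  show "(\<lambda>A. \<Union>b\<in>A. N' +>\<^bsub>M'\<^esub> f b) \<in> module_hom R (quot_module M N) (quot_module M' N')"
  proof (rule module_homI)
    fix A assume "A \<in> carrier (quot_module M N)"
    then obtain a where a: "a \<in> carrier M" "A = N +>\<^bsub>M\<^esub> a" by (auto simp: carrier_quot_module)
    thus "(\<Union>b\<in>A. N' +>\<^bsub>M'\<^esub> f b) \<in> carrier (quot_module M' N')"
      by (simp add: carrier_quot_module * module_hom_closed[OF f])
    fix B assume "B \<in> carrier (quot_module M N)"
    then obtain b where "b \<in> carrier M" "B = N +>\<^bsub>M\<^esub> b" by (auto simp: carrier_quot_module)
    thus "(\<Union>b\<in>A \<oplus>\<^bsub>quot_module M N\<^esub> B. N' +>\<^bsub>M'\<^esub> f b)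
        = (\<Union>b\<in>A. N' +>\<^bsub>M'\<^esub> f b) \<oplus>\<^bsub>quot_module M' N'\<^esub> (\<Union>b\<in>B. N' +>\<^bsub>M'\<^esub> f b)"
      using a by (simp add: * module_hom_closed[OF f] module_hom_add[OF f]
          module_hom_add[OF q, symmetric] module_hom_add[OF q', symmetric])
  next
    fix r A assume r: "r \<in> carrier R" and "A \<in> carrier (quot_module M N)"
    then obtain a where "a \<in> carrier M" "A = N +>\<^bsub>M\<^esub> a" by (auto simp: carrier_quot_module)
    thus "(\<Union>b\<in>r \<odot>\<^bsub>quot_module M N\<^esub> A. N' +>\<^bsub>M'\<^esub> f b)
        = r \<odot>\<^bsub>quot_module M' N'\<^esub> (\<Union>b\<in>A. N' +>\<^bsub>M'\<^esub> f b)"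
      using r by (simp add: * module_hom_closed[OF f] module_hom_smult[OF f]
          module_hom_smult[OF q, symmetric] module_hom_smult[OF q', symmetric])
  qed
qed

subsection \<open>Products and transport of structure\<close>

lemma module_prod_module:
  assumes R: "cring R" and M: "\<And>i. i \<in> I \<Longrightarrow> module R (M i)"
  shows "module R (prod_module I M)"
proof -
  have ab: "abelian_group (M i)" if "i \<in> I" for i using M[OF that] by (simp add: module_def)
  note abm = ab[THEN abelian_group.axioms(1)]
  show ?thesis
  proof (rule moduleI[OF R])
    show "abelian_group (prod_module I M)"
    proof (rule abelian_groupI)
      fix x assume x: "x \<in> carrier (prod_module I M)"
      have "(\<lambda>i\<in>I. \<ominus>\<^bsub>M i\<^esub> x i) \<in> carrier (prod_module I M)"
        using x by (auto simp: prod_module_def PiE_iff abelian_group.a_inv_closed[OF ab])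
      moreover have "(\<lambda>i\<in>I. \<ominus>\<^bsub>M i\<^esub> x i) \<oplus>\<^bsub>prod_module I M\<^esub> x = \<zero>\<^bsub>prod_module I M\<^esub>"
        using x by (auto simp: prod_module_def PiE_iff abelian_group.l_neg[OF ab] intro!: restrict_ext)
      ultimately show "\<exists>y\<in>carrier (prod_module I M). y \<oplus>\<^bsub>prod_module I M\<^esub> x = \<zero>\<^bsub>prod_module I M\<^esub>"
        by blast
    qed (simp_all add: prod_module_def PiE_iff extensional_restrict abelian_monoid.a_closed[OF abm]
        abelian_monoid.zero_closed[OF abm] abelian_monoid.a_assoc[OF abm]
        abelian_monoid.l_zero[OF abm] abelian_monoid.r_zero[OF abm] abelian_monoid.a_comm[OF abm]
        abelian_monoid.a_lcomm[OF abm] cong: restrict_cong)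
  qed (simp_all add: prod_module_def PiE_iff extensional_restrict module.smult_closed[OF M]
      module.smult_l_distr[OF M] module.smult_r_distr[OF M] module.smult_assoc1[OF M]
      module.smult_one[OF M] abelian_monoid.a_closed[OF abm] cong: restrict_cong)
qed

lemma transport_module_hom:
  assumes "inj_on h (carrier M)" "module R M"
  shows "h \<in> module_hom R M (transport_module h M)"
  using assms by (intro module_homI) (auto simp: transport_module_def Let_def)

lemma inv_transport_hom:
  assumes "inj_on h (carrier M)" "module R M"
  shows "inv_into (carrier M) h \<in> module_hom R (transport_module h M) M"
proof -
  interpret module R M by fact
  show ?thesis using assms(1) by (intro module_homI) (auto simp: transport_module_def Let_def)
qed

lemma module_transport_module:
  assumes "inj_on h (carrier M)" "module R M"
  shows "module R (transport_module h M)"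
  by (rule module_surjective_image[OF assms(2) transport_module_hom[OF assms]])
    (auto simp: transport_module_def Let_def)

lemma cring_field_ring: "cring (field_ring :: 'k::field ring)"
proof (rule cringI)
  show "abelian_group (field_ring :: 'k ring)"
    by (rule abelian_groupI) (auto simp: field_ring_def add.assoc add.commute intro: exI[of _ "- _"] left_minus)
  show "Group.comm_monoid (field_ring :: 'k ring)"
    by (rule comm_monoidI) (auto simp: field_ring_def)
qed (auto simp: field_ring_def distrib_right)

section \<open>Presheaves of vector spaces\<close>

text \<open>
  Operations on germs are written as unions over representatives \<open>(V, t)\<close>. This evaluates them once
  the result is known not to depend on the representative.
\<close>

lemma UN_pair_eqI:
  assumes "(V\<^sub>0, t\<^sub>0) \<in> A" and "\<And>V t. (V, t) \<in> A \<Longrightarrow> f V t = B"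
  shows "(\<Union>(V, t)\<in>A. f V t) = B"
proof -
  have "(\<Union>(V, t)\<in>A. f V t) = (\<Union>p\<in>A. B)" using assms(2) by (intro SUP_cong) auto
  thus ?thesis using assms(1) by auto
qed

text \<open>
  All the constructions that lead to the Godement resolution stay within presheaves of vector spaces:
  families of germs, sheafification, cokernels and transport along an injective encoding. This is what
  makes the terms of the resolution vector spaces and its differentials linear.
\<close>

locale vector_space_presheaf =
  fixes X :: "'x topology" and P :: "('x, 'k::field, 'a) presheaf"
  assumes module: "openin X U \<Longrightarrow> module field_ring (sect P U)"
    and res_hom: "openin X U \<Longrightarrow> openin X V \<Longrightarrow> V \<subseteq> U
      \<Longrightarrow> res P U V \<in> module_hom field_ring (sect P U) (sect P V)"
    and res_id: "openin X U \<Longrightarrow> s \<in> carrier (sect P U) \<Longrightarrow> res P U U s = s"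
    and res_res: "openin X U \<Longrightarrow> openin X V \<Longrightarrow> openin X W \<Longrightarrow> W \<subseteq> V \<Longrightarrow> V \<subseteq> U
      \<Longrightarrow> s \<in> carrier (sect P U) \<Longrightarrow> res P V W (res P U V s) = res P U W s"
begin

lemmas abelian_group_sect = module.axioms(2)[OF module]
lemmas zero_closed = abelian_monoid.zero_closed[OF abelian_group.axioms(1)[OF abelian_group_sect]]
lemmas add_closed = abelian_monoid.a_closed[OF abelian_group.axioms(1)[OF abelian_group_sect]]
lemmas smult_closed = module.smult_closed[OF module]
lemmas res_closed = module_hom_closed[OF res_hom]
lemmas res_add = module_hom_add[OF res_hom]
lemmas res_smult = module_hom_smult[OF res_hom]
lemmas res_zero = module_hom_zero[OF module module res_hom]

subsection \<open>Germs\<close>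

text \<open>
  Equality of germs is transitive: two neighbourhoods on which sections agree may be intersected.
\<close>

lemma germ_eqI:
  assumes U: "openin X U" "x \<in> U" "s \<in> carrier (sect P U)"
    and V: "openin X V" "x \<in> V" "t \<in> carrier (sect P V)"
    and W: "openin X W" "x \<in> W" "W \<subseteq> U \<inter> V" and eq: "res P U W s = res P V W t"
  shows "germ X P x U s = germ X P x V t"
proof -
  have sub: "germ X P x U s \<subseteq> germ X P x V t"
    if U: "openin X U" "x \<in> U" "s \<in> carrier (sect P U)"
      and V: "openin X V" "x \<in> V" "t \<in> carrier (sect P V)"
      and W: "openin X W" "x \<in> W" "W \<subseteq> U \<inter> V" and eq: "res P U W s = res P V W t" for U V W s t
  proof (clarsimp simp: germ_def)
    fix V' t' W'
    assume V': "openin X V'" "x \<in> V'" "t' \<in> carrier (sect P V')"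
      and W': "openin X W'" "x \<in> W'" "W' \<subseteq> U" "W' \<subseteq> V'" "res P U W' s = res P V' W' t'"
    have o: "openin X (W \<inter> W')" using W W' by auto
    have "res P V (W \<inter> W') t = res P W (W \<inter> W') (res P V W t)"
      using V W W' o by (intro res_res[symmetric]) auto
    also have "\<dots> = res P U (W \<inter> W') s"
      unfolding eq[symmetric] using U V W W' o by (intro res_res) auto
    also have "\<dots> = res P W' (W \<inter> W') (res P U W' s)"
      using U W W' o by (intro res_res[symmetric]) auto
    also have "\<dots> = res P V' (W \<inter> W') t'"
      unfolding W'(5) using V' W W' o by (intro res_res) auto
    finally show "\<exists>Wa. openin X Wa \<and> x \<in> Wa \<and> Wa \<subseteq> V \<and> Wa \<subseteq> V' \<and> res P V Wa t = res P V' Wa t'"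
      using W W' o by (intro exI[of _ "W \<inter> W'"]) auto
  qed
  show ?thesis
    using sub[OF U V W eq] sub[OF V U W(1,2) _ eq[symmetric]] W(3) by blast
qed

lemma germ_self:
  assumes "openin X U" "x \<in> U" "s \<in> carrier (sect P U)"
  shows "(U, s) \<in> germ X P x U s"
  using assms by (auto simp: germ_def)

lemma germ_memD:
  assumes "openin X U" "x \<in> U" "s \<in> carrier (sect P U)" "(V, t) \<in> germ X P x U s"
  shows "openin X V" "x \<in> V" "t \<in> carrier (sect P V)" "germ X P x V t = germ X P x U s"
proof -
  show V: "openin X V" "x \<in> V" "t \<in> carrier (sect P V)"
    using assms(4) by (auto simp: germ_def)
  obtain W where "openin X W" "x \<in> W" "W \<subseteq> U \<inter> V" "res P U W s = res P V W t"
    using assms(4) by (auto simp: germ_def)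
  thus "germ X P x V t = germ X P x U s"
    using germ_eqI[OF assms(1-3) V] by metis
qed

lemma germ_res:
  assumes "openin X U" "openin X V" "V \<subseteq> U" "x \<in> V" "s \<in> carrier (sect P U)"
  shows "germ X P x V (res P U V s) = germ X P x U s"
  using assms by (intro germ_eqI[of _ _ _ _ _ V]) (auto simp: res_closed res_id)

lemma stalkE:
  assumes "g \<in> carrier (stalk X P x)"
  obtains U s where "openin X U" "x \<in> U" "s \<in> carrier (sect P U)" "g = germ X P x U s"
  using assms by (auto simp: stalk_def)

lemma germ_in_stalk:
  "openin X U \<Longrightarrow> x \<in> U \<Longrightarrow> s \<in> carrier (sect P U) \<Longrightarrow> germ X P x U s \<in> carrier (stalk X P x)"
  by (auto simp: stalk_def)

lemma stalk_memD:
  assumes "g \<in> carrier (stalk X P x)" "(V, t) \<in> g"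
  shows "openin X V" "x \<in> V" "t \<in> carrier (sect P V)" "germ X P x V t = g"
  using assms by (auto elim!: stalkE dest: germ_memD)

lemma stalk_nonempty:
  assumes "g \<in> carrier (stalk X P x)"
  shows "g \<noteq> {}"
  using assms by (auto elim!: stalkE dest: germ_self)

text \<open>
  Germs can be compared and added as sections over one neighbourhood of the point, so identities in the
  stalk reduce to identities in a module of sections.
\<close>

lemma stalk_common:
  assumes "g \<in> carrier (stalk X P x)" "h \<in> carrier (stalk X P x)"
  obtains U s t where "openin X U" "x \<in> U" "s \<in> carrier (sect P U)" "t \<in> carrier (sect P U)"
    "g = germ X P x U s" "h = germ X P x U t"
proof -
  obtain U s where U: "openin X U" "x \<in> U" "s \<in> carrier (sect P U)" "g = germ X P x U s"
    using assms(1) by (rule stalkE)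
  obtain V t where V: "openin X V" "x \<in> V" "t \<in> carrier (sect P V)" "h = germ X P x V t"
    using assms(2) by (rule stalkE)
  show ?thesis
  proof (rule that)
    show "openin X (U \<inter> V)" "x \<in> U \<inter> V" using U V by auto
    show "res P U (U \<inter> V) s \<in> carrier (sect P (U \<inter> V))" "res P V (U \<inter> V) t \<in> carrier (sect P (U \<inter> V))"
      using U V by (auto intro!: res_closed)
    show "g = germ X P x (U \<inter> V) (res P U (U \<inter> V) s)" "h = germ X P x (U \<inter> V) (res P V (U \<inter> V) t)"
      using U V by (simp_all add: germ_res openin_Int)
  qed
qed

lemma germ_common:
  assumes U: "openin X U" "x \<in> U" "s \<in> carrier (sect P U)" and g: "g \<in> carrier (stalk X P x)"
  obtains W t where "openin X W" "x \<in> W" "W \<subseteq> U" "t \<in> carrier (sect P W)" "g = germ X P x W t"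
proof -
  obtain V t where V: "openin X V" "x \<in> V" "t \<in> carrier (sect P V)" "g = germ X P x V t"
    using g by (rule stalkE)
  show ?thesis
    by (rule that[of "U \<inter> V" "res P V (U \<inter> V) t"])
      (use U V in \<open>simp_all add: germ_res openin_Int res_closed\<close>)
qed

text \<open>
  The sum of germs is a union over all pairs of representatives. Any two such pairs agree on a common
  neighbourhood, where the restrictions are additive.
\<close>

lemma stalk_add:
  assumes "openin X U" "x \<in> U" "s \<in> carrier (sect P U)" "t \<in> carrier (sect P U)"
  shows "germ X P x U s \<oplus>\<^bsub>stalk X P x\<^esub> germ X P x U t = germ X P x U (s \<oplus>\<^bsub>sect P U\<^esub> t)"
proof -
  define f where "f = (\<lambda>U s V t. germ X P x (U \<inter> V) (res P U (U \<inter> V) s \<oplus>\<^bsub>sect P (U \<inter> V)\<^esub> res P V (U \<inter> V) t))"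
  have f: "f U' s' V' t' = f U s U t"
    if mem: "(U', s') \<in> germ X P x U s" "(V', t') \<in> germ X P x U t" for U' s' V' t'
  proof -
    obtain W1 where U': "openin X U'" "x \<in> U'" "s' \<in> carrier (sect P U')"
      and W1: "openin X W1" "x \<in> W1" "W1 \<subseteq> U \<inter> U'" "res P U W1 s = res P U' W1 s'"
      using mem(1) by (auto simp: germ_def)
    obtain W2 where V': "openin X V'" "x \<in> V'" "t' \<in> carrier (sect P V')"
      and W2: "openin X W2" "x \<in> W2" "W2 \<subseteq> U \<inter> V'" "res P U W2 t = res P V' W2 t'"
      using mem(2) by (auto simp: germ_def)
    define W where "W = W1 \<inter> W2"
    have W: "openin X W" "x \<in> W" "W \<subseteq> W1" "W \<subseteq> W2" using W1 W2 by (auto simp: W_def)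
    have WU: "W \<subseteq> U" "W \<subseteq> U'" "W \<subseteq> V'" using W1 W2 by (auto simp: W_def)
    have 1: "res P U W s = res P U' W s'"
      using W W1 assms(1,3) U' res_res[of U W1 W s] res_res[of U' W1 W s'] by auto
    have 2: "res P U W t = res P V' W t'"
      using W W2 assms(1,4) V' res_res[of U W2 W t] res_res[of V' W2 W t'] by auto
    show ?thesis unfolding f_def
    proof (rule germ_eqI[of _ _ _ _ _ W])
      have o: "openin X (U' \<inter> V')" "W \<subseteq> U' \<inter> V'" "W \<subseteq> U" using U' V' WU by auto
      have "res P (U' \<inter> V') W (res P U' (U' \<inter> V') s' \<oplus>\<^bsub>sect P (U' \<inter> V')\<^esub> res P V' (U' \<inter> V') t')
          = res P U' W s' \<oplus>\<^bsub>sect P W\<^esub> res P V' W t'"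
        using W o U' V' by (simp add: res_add res_closed res_res)
      moreover have "res P (U \<inter> U) W (res P U (U \<inter> U) s \<oplus>\<^bsub>sect P (U \<inter> U)\<^esub> res P U (U \<inter> U) t)
          = res P U W s \<oplus>\<^bsub>sect P W\<^esub> res P U W t"
        using assms W o by (simp add: res_add res_id)
      ultimately show "res P (U' \<inter> V') W (res P U' (U' \<inter> V') s' \<oplus>\<^bsub>sect P (U' \<inter> V')\<^esub> res P V' (U' \<inter> V') t')
          = res P (U \<inter> U) W (res P U (U \<inter> U) s \<oplus>\<^bsub>sect P (U \<inter> U)\<^esub> res P U (U \<inter> U) t)"
        using 1 2 by simp
    qed (use assms U' V' W WU in \<open>simp_all add: res_closed add_closed openin_Int\<close>)
  qed
  have "germ X P x U s \<oplus>\<^bsub>stalk X P x\<^esub> germ X P x U t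
      = (\<Union>(U', s')\<in>germ X P x U s. \<Union>(V', t')\<in>germ X P x U t. f U' s' V' t')"
    by (simp add: stalk_def f_def)
  also have "\<dots> = f U s U t"
    by (rule UN_pair_eqI[OF germ_self[OF assms(1,2,3)] UN_pair_eqI[OF germ_self[OF assms(1,2,4)] f]])
  also have "\<dots> = germ X P x U (s \<oplus>\<^bsub>sect P U\<^esub> t)" using assms by (simp add: f_def res_id)
  finally show ?thesis .
qed

lemma stalk_smult:
  assumes "openin X U" "x \<in> U" "s \<in> carrier (sect P U)" "r \<in> carrier field_ring"
  shows "r \<odot>\<^bsub>stalk X P x\<^esub> germ X P x U s = germ X P x U (r \<odot>\<^bsub>sect P U\<^esub> s)"
proof -
  have "germ X P x V (r \<odot>\<^bsub>sect P V\<^esub> t) = germ X P x U (r \<odot>\<^bsub>sect P U\<^esub> s)"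
    if mem: "(V, t) \<in> germ X P x U s" for V t
  proof -
    obtain W where V: "openin X V" "x \<in> V" "t \<in> carrier (sect P V)"
      and W: "openin X W" "x \<in> W" "W \<subseteq> U \<inter> V" "res P U W s = res P V W t"
      using mem by (auto simp: germ_def)
    show ?thesis using V W assms
      by (intro germ_eqI[of _ _ _ _ _ W]) (auto simp: res_smult smult_closed)
  qed
  thus ?thesis by (auto simp: stalk_def intro!: UN_pair_eqI[OF germ_self[OF assms(1-3)]])
qed

lemma stalk_zero:
  assumes "openin X U" "x \<in> U"
  shows "\<zero>\<^bsub>stalk X P x\<^esub> = germ X P x U \<zero>\<^bsub>sect P U\<^esub>"
  using assms germ_res[of "topspace X" U x "\<zero>\<^bsub>sect P (topspace X)\<^esub>"]
  by (simp add: stalk_def res_zero zero_closed openin_subset)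

lemma module_stalk:
  assumes x: "x \<in> topspace X"
  shows "module field_ring (stalk X P x)"
proof -
  note comm = stalk_add stalk_smult germ_in_stalk add_closed smult_closed zero_closed
    stalk_zero
  show ?thesis
  proof (rule moduleI[OF cring_field_ring])
    show "abelian_group (stalk X P x)"
    proof (rule abelian_groupI)
      fix g h assume g: "g \<in> carrier (stalk X P x)" and h: "h \<in> carrier (stalk X P x)"
      then obtain U s t where U: "openin X U" "x \<in> U" "s \<in> carrier (sect P U)" "t \<in> carrier (sect P U)"
        "g = germ X P x U s" "h = germ X P x U t" by (rule stalk_common)
      interpret M: module field_ring "sect P U" using U(1) by (rule module)
      show "g \<oplus>\<^bsub>stalk X P x\<^esub> h \<in> carrier (stalk X P x)" using U by (simp add: comm)
      show "g \<oplus>\<^bsub>stalk X P x\<^esub> h = h \<oplus>\<^bsub>stalk X P x\<^esub> g" using U by (simp add: comm M.M.a_comm)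
      fix k assume "k \<in> carrier (stalk X P x)"
      then obtain W u where W: "openin X W" "x \<in> W" "W \<subseteq> U" "u \<in> carrier (sect P W)"
        "k = germ X P x W u" using germ_common U by metis
      interpret N: module field_ring "sect P W" using W(1) by (rule module)
      have g: "g = germ X P x W (res P U W s)" and h: "h = germ X P x W (res P U W t)"
        using U W by (simp_all add: germ_res)
      have "res P U W s \<in> carrier (sect P W)" "res P U W t \<in> carrier (sect P W)"
        using U W by (simp_all add: res_closed)
      thus "(g \<oplus>\<^bsub>stalk X P x\<^esub> h) \<oplus>\<^bsub>stalk X P x\<^esub> k = g \<oplus>\<^bsub>stalk X P x\<^esub> (h \<oplus>\<^bsub>stalk X P x\<^esub> k)"
        unfolding g h W(5) using W by (simp add: comm N.M.a_assoc)
    next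
      fix g assume "g \<in> carrier (stalk X P x)"
      then obtain U s where U: "openin X U" "x \<in> U" "s \<in> carrier (sect P U)" "g = germ X P x U s"
        by (rule stalkE)
      interpret M: module field_ring "sect P U" using U(1) by (rule module)
      show "\<zero>\<^bsub>stalk X P x\<^esub> \<oplus>\<^bsub>stalk X P x\<^esub> g = g" using U by (simp add: comm stalk_zero[of U])
      show "\<exists>h\<in>carrier (stalk X P x). h \<oplus>\<^bsub>stalk X P x\<^esub> g = \<zero>\<^bsub>stalk X P x\<^esub>"
        by (rule bexI[of _ "germ X P x U (\<ominus>\<^bsub>sect P U\<^esub> s)"])
          (use U in \<open>simp_all add: comm stalk_zero[of U] M.M.l_neg\<close>)
    next
      show "\<zero>\<^bsub>stalk X P x\<^esub> \<in> carrier (stalk X P x)"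
        using x stalk_zero[of "topspace X"] by (auto simp: germ_in_stalk zero_closed)
    qed
  next
    fix a b :: 'k and g
    assume ab: "a \<in> carrier field_ring" "b \<in> carrier field_ring" and "g \<in> carrier (stalk X P x)"
    then obtain U s where U: "openin X U" "x \<in> U" "s \<in> carrier (sect P U)" "g = germ X P x U s"
      by (elim stalkE)
    interpret M: module field_ring "sect P U" using U(1) by (rule module)
    show "a \<odot>\<^bsub>stalk X P x\<^esub> g \<in> carrier (stalk X P x)" using ab U by (simp add: comm)
    show "(a \<oplus>\<^bsub>field_ring\<^esub> b) \<odot>\<^bsub>stalk X P x\<^esub> g
        = a \<odot>\<^bsub>stalk X P x\<^esub> g \<oplus>\<^bsub>stalk X P x\<^esub> b \<odot>\<^bsub>stalk X P x\<^esub> g"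
      using ab U by (simp add: comm M.smult_l_distr)
    show "(a \<otimes>\<^bsub>field_ring\<^esub> b) \<odot>\<^bsub>stalk X P x\<^esub> g = a \<odot>\<^bsub>stalk X P x\<^esub> (b \<odot>\<^bsub>stalk X P x\<^esub> g)"
      using ab U by (simp add: comm M.smult_assoc1)
  next
    fix a :: 'k and g h
    assume a: "a \<in> carrier field_ring" and gh: "g \<in> carrier (stalk X P x)" "h \<in> carrier (stalk X P x)"
    obtain U s t where U: "openin X U" "x \<in> U" "s \<in> carrier (sect P U)" "t \<in> carrier (sect P U)"
      "g = germ X P x U s" "h = germ X P x U t" using gh by (rule stalk_common)
    interpret M: module field_ring "sect P U" using U(1) by (rule module)
    show "a \<odot>\<^bsub>stalk X P x\<^esub> (g \<oplus>\<^bsub>stalk X P x\<^esub> h)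
        = a \<odot>\<^bsub>stalk X P x\<^esub> g \<oplus>\<^bsub>stalk X P x\<^esub> a \<odot>\<^bsub>stalk X P x\<^esub> h"
      using a U by (simp add: comm M.smult_r_distr)
  next
    fix g assume "g \<in> carrier (stalk X P x)"
    then obtain U s where U: "openin X U" "x \<in> U" "s \<in> carrier (sect P U)" "g = germ X P x U s"
      by (rule stalkE)
    interpret M: module field_ring "sect P U" using U(1) by (rule module)
    show "\<one>\<^bsub>field_ring\<^esub> \<odot>\<^bsub>stalk X P x\<^esub> g = g" using U by (simp add: comm)
  qed
qed

end

subsection \<open>Constructions of presheaves\<close>

lemma vector_space_presheaf_quot:
  assumes "vector_space_presheaf X P"
    and N: "\<And>U. openin X U \<Longrightarrow> submodule (N U) field_ring (sect P U)"
    and res: "\<And>U V. openin X U \<Longrightarrow> openin X V \<Longrightarrow> V \<subseteq> U \<Longrightarrow> res P U V ` N U \<subseteq> N V"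
  shows "vector_space_presheaf X (quot_presheaf P N)"
proof -
  interpret vector_space_presheaf X P by fact
  note q = quot_union_hom[OF module module N N res_hom res]
  show ?thesis
  proof (rule vector_space_presheaf.intro)
    fix U assume "openin X U"
    thus "module field_ring (sect (quot_presheaf P N) U)"
      by (auto simp: quot_presheaf_def intro!: module_quot_module module N)
  next
    fix U V assume "openin X U" "openin X V" "V \<subseteq> U"
    thus "res (quot_presheaf P N) U V
        \<in> module_hom field_ring (sect (quot_presheaf P N) U) (sect (quot_presheaf P N) V)"
      using q(2) by (simp add: quot_presheaf_def)
  next
    fix U s assume U: "openin X U" and "s \<in> carrier (sect (quot_presheaf P N) U)"
    then obtain a where "a \<in> carrier (sect P U)" "s = N U +>\<^bsub>sect P U\<^esub> a"
      by (auto simp: quot_presheaf_def carrier_quot_module)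
    thus "res (quot_presheaf P N) U U s = s"
      using U by (simp add: quot_presheaf_def q(1) res_id)
  next
    fix U V W s
    assume o: "openin X U" "openin X V" "openin X W" "W \<subseteq> V" "V \<subseteq> U"
      and "s \<in> carrier (sect (quot_presheaf P N) U)"
    then obtain a where "a \<in> carrier (sect P U)" "s = N U +>\<^bsub>sect P U\<^esub> a"
      by (auto simp: quot_presheaf_def carrier_quot_module)
    moreover have "W \<subseteq> U" using o by auto
    ultimately show "res (quot_presheaf P N) V W (res (quot_presheaf P N) U V s)
        = res (quot_presheaf P N) U W s"
      using o by (simp add: quot_presheaf_def q(1) res_closed res_res)
  qed
qed

text \<open>
  The restriction maps of the transported presheaf are the conjugates by \<open>h\<close> of the given ones.
\<close>

lemma vector_space_presheaf_transport:
  assumes "vector_space_presheaf X P"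
    and inj: "\<And>U. openin X U \<Longrightarrow> inj_on h (carrier (sect P U))"
  shows "vector_space_presheaf X (transport_presheaf h P)"
proof -
  interpret vector_space_presheaf X P by fact
  have c: "carrier (transport_module h M) = h ` carrier M" for M :: "('b, 'c) module"
    by (simp add: transport_module_def Let_def)
  show ?thesis
  proof (rule vector_space_presheaf.intro)
    fix U assume "openin X U"
    thus "module field_ring (sect (transport_presheaf h P) U)"
      by (auto simp: transport_presheaf_def intro!: module_transport_module module inj)
  next
    fix U V assume o: "openin X U" "openin X V" "V \<subseteq> U"
    show "res (transport_presheaf h P) U V
        \<in> module_hom field_ring (sect (transport_presheaf h P) U) (sect (transport_presheaf h P) V)"
      using module_hom_compose[OF inv_transport_hom[OF inj module, OF o(1) o(1)]
          module_hom_compose[OF res_hom[OF o] transport_module_hom[OF inj module, OF o(2) o(2)]]]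
      by (simp add: transport_presheaf_def)
  next
    fix U s assume "openin X U" "s \<in> carrier (sect (transport_presheaf h P) U)"
    thus "res (transport_presheaf h P) U U s = s"
      using inj by (auto simp: transport_presheaf_def c res_id)
  next
    fix U V W s
    assume "openin X U" "openin X V" "openin X W" "W \<subseteq> V" "V \<subseteq> U"
      and "s \<in> carrier (sect (transport_presheaf h P) U)"
    thus "res (transport_presheaf h P) V W (res (transport_presheaf h P) U V s)
        = res (transport_presheaf h P) U W s"
      using inj by (auto simp: transport_presheaf_def c res_res res_closed)
  qed
qed

context vector_space_presheaf
begin

lemma vector_space_presheaf_godement: "vector_space_presheaf X (godement X P)"
proof (rule vector_space_presheaf.intro)
  show "module field_ring (sect (godement X P) U)" if "openin X U" for U
    using that openin_subset[OF that]
    by (auto simp: godement_def intro!: module_prod_module cring_field_ring module_stalk)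
  show "res (godement X P) U V \<in> module_hom field_ring (sect (godement X P) U) (sect (godement X P) V)"
    if "openin X U" "openin X V" "V \<subseteq> U" for U V
    using that(3) by (intro module_homI)
      (auto simp: godement_def prod_module_def restrict_def fun_eq_iff PiE_iff subset_iff extensional_def)
  show "res (godement X P) U U s = s" if "s \<in> carrier (sect (godement X P) U)" for U s
    using that by (simp add: godement_def prod_module_def PiE_iff extensional_restrict)
  show "res (godement X P) V W (res (godement X P) U V s) = res (godement X P) U W s"
    if "W \<subseteq> V" "V \<subseteq> U" for U V W s
    using that by (simp add: godement_def Int_absorb1)
qed

lemma germs_hom:
  assumes U: "openin X U"
  shows "germs X P U \<in> module_hom field_ring (sect P U) (sect (godement X P) U)"
  using U by (intro module_homI)
    (auto simp: germs_def godement_def prod_module_def germ_in_stalk stalk_add stalk_smult intro!: restrict_ext)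

lemma germs_res:
  assumes "openin X U" "openin X V" "V \<subseteq> U" "s \<in> carrier (sect P U)"
  shows "restrict (germs X P U s) V = germs X P V (res P U V s)"
  using assms by (auto simp: germs_def germ_res restrict_def fun_eq_iff)

text \<open>
  A section of the sheafification is locally a family of germs of a section of \<open>P\<close>. Such local sections
  can be restricted to a common neighbourhood and added there.
\<close>

lemma sheafify_submodule:
  assumes U: "openin X U"
  shows "submodule (carrier (sect (sheafify X P) U)) field_ring (sect (godement X P) U)"
proof -
  interpret G: vector_space_presheaf X "godement X P" by (rule vector_space_presheaf_godement)
  interpret M: module field_ring "sect (godement X P) U" using U by (rule G.module)
  have loc: "\<exists>V t. openin X V \<and> x \<in> V \<and> V \<subseteq> U \<and> t \<in> carrier (sect P V) \<and> restrict s V = germs X P V t"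
    if "s \<in> carrier (sect (sheafify X P) U)" "x \<in> U" for s x
    using that by (auto simp: sheafify_def)
  have car: "s \<in> carrier (sect (godement X P) U)" if "s \<in> carrier (sect (sheafify X P) U)" for s
    using that by (auto simp: sheafify_def)
  have I: "s \<in> carrier (sect (sheafify X P) U)" if "s \<in> carrier (sect (godement X P) U)"
    "\<And>x. x \<in> U \<Longrightarrow> \<exists>V t. openin X V \<and> x \<in> V \<and> V \<subseteq> U \<and> t \<in> carrier (sect P V) \<and> restrict s V = germs X P V t" for s
    using that by (auto simp: sheafify_def)
  have res: "res (godement X P) U V s = restrict s V" for V s by (simp add: godement_def)
  show ?thesis
  proof (rule M.submoduleI_without_inverses)
    show "\<zero>\<^bsub>sect (godement X P) U\<^esub> \<in> carrier (sect (sheafify X P) U)"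
    proof (rule I)
      fix x assume "x \<in> U"
      have "restrict \<zero>\<^bsub>sect (godement X P) U\<^esub> U = germs X P U \<zero>\<^bsub>sect P U\<^esub>"
        using module_hom_zero[OF module G.module germs_hom, OF U U U] G.res_id[OF U M.M.zero_closed]
        by (simp add: res)
      thus "\<exists>V t. openin X V \<and> x \<in> V \<and> V \<subseteq> U \<and> t \<in> carrier (sect P V)
          \<and> restrict \<zero>\<^bsub>sect (godement X P) U\<^esub> V = germs X P V t"
        using U \<open>x \<in> U\<close> zero_closed[OF U] by blast
    qed simp
  next
    fix s s' assume s: "s \<in> carrier (sect (sheafify X P) U)" "s' \<in> carrier (sect (sheafify X P) U)"
    show "s \<oplus>\<^bsub>sect (godement X P) U\<^esub> s' \<in> carrier (sect (sheafify X P) U)"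
    proof (rule I)
      fix x assume x: "x \<in> U"
      obtain V t where V: "openin X V" "x \<in> V" "V \<subseteq> U" "t \<in> carrier (sect P V)" "restrict s V = germs X P V t"
        using loc[OF s(1) x] by blast
      obtain V' t' where V': "openin X V'" "x \<in> V'" "V' \<subseteq> U" "t' \<in> carrier (sect P V')" "restrict s' V' = germs X P V' t'"
        using loc[OF s(2) x] by blast
      let ?W = "V \<inter> V'"
      have W: "openin X ?W" "?W \<subseteq> U" using V V' by auto
      have 1: "restrict s ?W = germs X P ?W (res P V ?W t)"
        using germs_res[OF V(1) W(1) _ V(4)] unfolding V(5)[symmetric] by (simp add: Int_absorb1)
      have 2: "restrict s' ?W = germs X P ?W (res P V' ?W t')"
        using germs_res[OF V'(1) W(1) _ V'(4)] unfolding V'(5)[symmetric] by (simp add: Int_ac Int_absorb1)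
      have "restrict (s \<oplus>\<^bsub>sect (godement X P) U\<^esub> s') ?W
          = germs X P ?W (res P V ?W t \<oplus>\<^bsub>sect P ?W\<^esub> res P V' ?W t')"
        using G.res_add[OF U W car car, OF s] V V' W
        by (simp add: res 1 2 module_hom_add[OF germs_hom] res_closed)
      thus "\<exists>W u. openin X W \<and> x \<in> W \<and> W \<subseteq> U \<and> u \<in> carrier (sect P W)
          \<and> restrict (s \<oplus>\<^bsub>sect (godement X P) U\<^esub> s') W = germs X P W u"
        using V V' W by (intro exI[of _ ?W] exI conjI) (auto intro!: add_closed res_closed)
    qed (use s car in auto)
  next
    fix r :: 'k and s assume r: "r \<in> carrier field_ring" and s: "s \<in> carrier (sect (sheafify X P) U)"
    show "r \<odot>\<^bsub>sect (godement X P) U\<^esub> s \<in> carrier (sect (sheafify X P) U)"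
    proof (rule I)
      fix x assume x: "x \<in> U"
      obtain V t where V: "openin X V" "x \<in> V" "V \<subseteq> U" "t \<in> carrier (sect P V)" "restrict s V = germs X P V t"
        using loc[OF s x] by blast
      have "restrict (r \<odot>\<^bsub>sect (godement X P) U\<^esub> s) V = germs X P V (r \<odot>\<^bsub>sect P V\<^esub> t)"
        using G.res_smult[OF U V(1,3) r car[OF s]] V r by (simp add: res module_hom_smult[OF germs_hom])
      thus "\<exists>W u. openin X W \<and> x \<in> W \<and> W \<subseteq> U \<and> u \<in> carrier (sect P W)
          \<and> restrict (r \<odot>\<^bsub>sect (godement X P) U\<^esub> s) W = germs X P W u"
        using V r by (intro exI[of _ V] exI conjI) (auto intro!: smult_closed)
    qed (use s r car in auto)
  qed (use car in auto)
qed

lemma sect_sheafify: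
  "sect (sheafify X P) U = (sect (godement X P) U)\<lparr>carrier := carrier (sect (sheafify X P) U)\<rparr>"
  by (simp add: sheafify_def)

lemma sheafify_sect_subset: "carrier (sect (sheafify X P) U) \<subseteq> carrier (sect (godement X P) U)"
  by (auto simp: sheafify_def)

lemma module_sheafify: "openin X U \<Longrightarrow> module field_ring (sect (sheafify X P) U)"
  using submodule.submodule_is_module[OF sheafify_submodule vector_space_presheaf.module[OF vector_space_presheaf_godement]]
  by (subst sect_sheafify) blast

lemma vector_space_presheaf_sheafify: "vector_space_presheaf X (sheafify X P)"
proof -
  interpret G: vector_space_presheaf X "godement X P" by (rule vector_space_presheaf_godement)
  note car = sheafify_sect_subset[THEN subsetD]
  have res: "res (sheafify X P) = res (godement X P)" by (simp add: sheafify_def)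
  have op: "add (sect (sheafify X P) U) = add (sect (godement X P) U)"
    "module.smult (sect (sheafify X P) U) = module.smult (sect (godement X P) U)" for U
    by (simp_all add: sheafify_def)
  show ?thesis
  proof (rule vector_space_presheaf.intro)
    fix U V assume o: "openin X U" "openin X V" "V \<subseteq> U"
    show "res (sheafify X P) U V \<in> module_hom field_ring (sect (sheafify X P) U) (sect (sheafify X P) V)"
    proof (rule module_homI)
      fix s assume s: "s \<in> carrier (sect (sheafify X P) U)"
      have "\<exists>W t. openin X W \<and> x \<in> W \<and> W \<subseteq> V \<and> t \<in> carrier (sect P W) \<and> restrict (restrict s V) W = germs X P W t"
        if x: "x \<in> V" for x
      proof -
        obtain W t where W: "openin X W" "x \<in> W" "W \<subseteq> U" "t \<in> carrier (sect P W)" "restrict s W = germs X P W t"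
          using s x o(3) unfolding sheafify_def by simp blast
        have o': "openin X (W \<inter> V)" using o W by auto
        have "restrict (restrict s V) (W \<inter> V) = restrict (restrict s W) (W \<inter> V)"
          by (auto simp: restrict_def fun_eq_iff)
        also have "\<dots> = germs X P (W \<inter> V) (res P W (W \<inter> V) t)"
          unfolding W(5) using o' W by (intro germs_res) auto
        finally show ?thesis using o' W x by (intro exI[of _ "W \<inter> V"] exI conjI) (auto intro!: res_closed)
      qed
      thus "res (sheafify X P) U V s \<in> carrier (sect (sheafify X P) V)"
        using G.res_closed[OF o car[OF s]] by (auto simp: sheafify_def godement_def)
    qed (simp_all add: res op car G.res_add[OF o] G.res_smult[OF o])
  qed (simp_all add: module_sheafify res car G.res_id G.res_res)
qed

lemma germs_hom_sheafify:
  assumes U: "openin X U"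
  shows "germs X P U \<in> module_hom field_ring (sect P U) (sect (sheafify X P) U)"
proof -
  have "germs X P U s \<in> carrier (sect (sheafify X P) U)" if s: "s \<in> carrier (sect P U)" for s
  proof -
    have "restrict (germs X P U s) U = germs X P U s" by (simp add: germs_def)
    thus ?thesis
      using s U module_hom_closed[OF germs_hom[OF U] s] by (auto simp: sheafify_def)
  qed
  thus ?thesis
    using germs_hom[OF U] by (auto simp: module_hom_def sheafify_def)
qed

lemma germs_image_submodule:
  assumes U: "openin X U"
  shows "submodule (germs X P U ` carrier (sect P U)) field_ring (sect (godement X P) U)"
  using image_submodule[OF module vector_space_presheaf.module[OF vector_space_presheaf_godement] germs_hom] U
  by blast

lemma vector_space_presheaf_godement_quot: "vector_space_presheaf X (godement_quot X P)"
  unfolding godement_quot_def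
proof (rule vector_space_presheaf_quot[OF vector_space_presheaf_godement germs_image_submodule])
  fix U V assume "openin X U" "openin X V" "V \<subseteq> U"
  thus "res (godement X P) U V ` germs X P U ` carrier (sect P U) \<subseteq> germs X P V ` carrier (sect P V)"
    by (auto simp: godement_def germs_res intro!: imageI res_closed)
qed

end

section \<open>The Godement resolution\<close>

text \<open>
  A coset is determined by any of its elements; the encoding of cosets by representatives relies on it.
\<close>

lemma coset_mem:
  assumes M: "module R M" and N: "submodule N R M" and A: "A \<in> carrier (quot_module M N)"
  shows "A \<noteq> {}" "\<And>a. a \<in> A \<Longrightarrow> a \<in> carrier M \<and> A = N +>\<^bsub>M\<^esub> a"
proof -
  interpret M: module R M by fact
  interpret N: abelian_subgroup N M using N by (rule M.abelian_subgroup_submodule)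
  obtain a where a: "a \<in> carrier M" "A = N +>\<^bsub>M\<^esub> a" using A by (auto simp: carrier_quot_module)
  show "A \<noteq> {}" using a N.a_rcos_self by auto
  show "b \<in> carrier M \<and> A = N +>\<^bsub>M\<^esub> b" if b: "b \<in> A" for b
    using M.coset_eqI[OF N a(1)] b a M.a_r_coset_subset_G[OF N.a_subset a(1)] by auto
qed

context vector_space_presheaf
begin

lemma sect_godement_quot:
  "sect (godement_quot X P) U = quot_module (sect (godement X P) U) (germs X P U ` carrier (sect P U))"
  by (simp add: godement_quot_def quot_presheaf_def)

lemma godement_quot_mem:
  assumes U: "openin X U" and A: "A \<in> carrier (sect (godement_quot X P) U)"
  shows "A \<noteq> {}" "a \<in> A \<Longrightarrow> a \<in> carrier (sect (godement X P) U) \<and>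
    A = germs X P U ` carrier (sect P U) +>\<^bsub>sect (godement X P) U\<^esub> a"
  using coset_mem[OF vector_space_presheaf.module[OF vector_space_presheaf_godement U]
    germs_image_submodule[OF U] A[unfolded sect_godement_quot]] by blast+

lemma stalk_disjoint:
  "g \<in> carrier (stalk X P x) \<Longrightarrow> h \<in> carrier (stalk X P x) \<Longrightarrow> p \<in> g \<Longrightarrow> p \<in> h \<Longrightarrow> g = h"
  by (cases p) (metis stalk_memD(4))

end

text \<open>
  A section of the sheafified cokernel is a family of germs of cosets of families of germs. The encoding
  chooses an element at each of these three levels, and since distinct germs at a point, and distinct
  cosets, are disjoint, the chosen elements determine the classes from the inside out.
\<close>

lemma inj_encode:
  fixes P :: "('x, 'k::field, ('x, 'a) code) presheaf"
  assumes P: "vector_space_presheaf X P" and U: "openin X U"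
  shows "inj_on encode (carrier (sect (sheafify X (godement_quot X P)) U))"
proof (rule inj_onI, rule ext)
  interpret P: vector_space_presheaf X P by fact
  define Q where "Q = godement_quot X P"
  interpret Q: vector_space_presheaf X Q
    unfolding Q_def by (rule P.vector_space_presheaf_godement_quot)
  fix s s' x
  assume "s \<in> carrier (sect (sheafify X (godement_quot X P)) U)"
    "s' \<in> carrier (sect (sheafify X (godement_quot X P)) U)" and eq: "encode s = encode s'"
  hence s: "s \<in> (\<Pi>\<^sub>E x\<in>U. carrier (stalk X Q x))" "s' \<in> (\<Pi>\<^sub>E x\<in>U. carrier (stalk X Q x))"
    by (auto simp: sheafify_def godement_def prod_module_def Q_def)
  show "s x = s' x"
  proof (cases "x \<in> U")
    case False
    thus ?thesis using PiE_arb[OF s(1)] PiE_arb[OF s(2)] by simp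
  next
    case True
    hence sx: "s x \<in> carrier (stalk X Q x)" "s' x \<in> carrier (stalk X Q x)" using s by auto
    obtain V A where VA: "some_elem (s x) = (V, A)" by (cases "some_elem (s x)")
    obtain V' A' where VA': "some_elem (s' x) = (V', A')" by (cases "some_elem (s' x)")
    have m: "(V, A) \<in> s x" "(V', A') \<in> s' x"
      using some_elem_nonempty[OF Q.stalk_nonempty[OF sx(1)]]
        some_elem_nonempty[OF Q.stalk_nonempty[OF sx(2)]] VA VA' by simp_all
    have V: "openin X V" "A \<in> carrier (sect (godement_quot X P) V)"
      using Q.stalk_memD[OF sx(1) m(1)] by (auto simp: Q_def)
    have V': "openin X V'" "A' \<in> carrier (sect (godement_quot X P) V')"
      using Q.stalk_memD[OF sx(2) m(2)] by (auto simp: Q_def)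
    define a where "a = some_elem A"
    define a' where "a' = some_elem A'"
    have "a \<in> A" "a' \<in> A'"
      unfolding a_def a'_def
      using P.godement_quot_mem(1)[OF V] P.godement_quot_mem(1)[OF V'] by (auto intro: some_elem_nonempty)
    note a = P.godement_quot_mem(2)[OF V this(1)] P.godement_quot_mem(2)[OF V' this(2)]
    have VV: "V = V'" and ay: "some_elem (a y) = some_elem (a' y)" for y
      using fun_cong[OF eq[unfolded encode_def code.inject], of x]
      by (auto simp: VA VA' a_def a'_def fun_eq_iff)
    \<comment> \<open>Off \<open>V\<close> both families are \<open>undefined\<close>; on \<open>V\<close> their germs share the chosen representative.\<close>
    have "a y = a' y" for y
    proof (cases "y \<in> V")
      case True
      hence st: "a y \<in> carrier (stalk X P y)" "a' y \<in> carrier (stalk X P y)"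
        using a VV by (auto simp: godement_def prod_module_def)
      have "some_elem (a y) \<in> a y" "some_elem (a y) \<in> a' y"
        using some_elem_nonempty[OF P.stalk_nonempty[OF st(1)]]
          some_elem_nonempty[OF P.stalk_nonempty[OF st(2)]] ay[of y] by simp_all
      thus ?thesis using P.stalk_disjoint st by blast
    next
      case False
      hence "a y = undefined" "a' y = undefined"
        using a VV by (auto simp: godement_def prod_module_def PiE_iff extensional_def)
      thus ?thesis by simp
    qed
    hence "a = a'" by (rule ext)
    hence "A = A'" using a VV by simp
    thus ?thesis using Q.stalk_disjoint[OF sx] m VV by blast
  qed
qed

context vector_space_presheaf
begin

lemma resolution_Z_presheaf: "vector_space_presheaf X (resolution_Z X P n)"
proof (induction n)
  case 0
  show ?case
    by (auto intro!: vector_space_presheaf_transport vector_space_presheaf_axioms inj_onI)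
next
  case (Suc n)
  interpret Z: vector_space_presheaf X "resolution_Z X P n" by fact
  interpret Q: vector_space_presheaf X "godement_quot X (resolution_Z X P n)"
    by (rule Z.vector_space_presheaf_godement_quot)
  show ?case
    by (auto intro!: vector_space_presheaf_transport Q.vector_space_presheaf_sheafify
        inj_encode Z.vector_space_presheaf_axioms)
qed

lemma module_resolution: "openin X U \<Longrightarrow> module field_ring (sect (resolution X P n) U)"
  unfolding resolution_def
  by (intro vector_space_presheaf.module[OF vector_space_presheaf.vector_space_presheaf_godement]
      resolution_Z_presheaf)

text \<open>
  The differential is the composite of the linear maps \<open>C\<^sup>n \<rightarrow> C\<^sup>n / Z\<^sup>n\<close>, its sheafification map, the
  encoding onto \<open>Z\<^sup>n\<^sup>+\<^sup>1\<close>, and \<open>Z\<^sup>n\<^sup>+\<^sup>1 \<rightarrow> C\<^sup>n\<^sup>+\<^sup>1\<close>.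
\<close>

lemma resolution_diff_hom:
  assumes U: "openin X U"
  shows "resolution_diff X P n U
    \<in> module_hom field_ring (sect (resolution X P n) U) (sect (resolution X P (Suc n)) U)"
proof -
  define Z where "Z = resolution_Z X P n"
  interpret Z: vector_space_presheaf X Z unfolding Z_def by (rule resolution_Z_presheaf)
  interpret Q: vector_space_presheaf X "godement_quot X Z"
    by (rule Z.vector_space_presheaf_godement_quot)
  interpret Z': vector_space_presheaf X "resolution_Z X P (Suc n)" by (rule resolution_Z_presheaf)
  have 1: "(\<lambda>s. germs X Z U ` carrier (sect Z U) +>\<^bsub>sect (resolution X P n) U\<^esub> s)
      \<in> module_hom field_ring (sect (resolution X P n) U) (sect (godement_quot X Z) U)"
    using quot_map_hom[OF vector_space_presheaf.module[OF Z.vector_space_presheaf_godement U]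
        Z.germs_image_submodule[OF U]]
    unfolding resolution_def Z_def[symmetric] Z.sect_godement_quot .
  have 2: "encode \<in> module_hom field_ring (sect (sheafify X (godement_quot X Z)) U)
      (sect (resolution_Z X P (Suc n)) U)"
    using transport_module_hom[OF inj_encode[OF Z.vector_space_presheaf_axioms U] Q.module_sheafify[OF U]]
    by (simp add: transport_presheaf_def Z_def)
  have 3: "germs X (resolution_Z X P (Suc n)) U
      \<in> module_hom field_ring (sect (resolution_Z X P (Suc n)) U) (sect (resolution X P (Suc n)) U)"
    using Z'.germs_hom[OF U] by (simp add: resolution_def)
  show ?thesis
    using module_hom_compose[OF 1 module_hom_compose[OF Q.germs_hom_sheafify[OF U]
          module_hom_compose[OF 2 3]]]
    by (simp add: resolution_diff_def[abs_def] Let_def Z_def)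
qed

text \<open>
  The first differential takes values in the image of \<open>Z\<^sup>n\<^sup>+\<^sup>1\<close>, which the second one divides out.
\<close>

lemma resolution_diff_diff:
  assumes U: "openin X U" and s: "s \<in> carrier (sect (resolution X P n) U)"
  shows "resolution_diff X P (Suc n) U (resolution_diff X P n U s) = \<zero>\<^bsub>sect (resolution X P (Suc (Suc n))) U\<^esub>"
proof -
  define Z where "Z = resolution_Z X P (Suc n)"
  interpret Z: vector_space_presheaf X Z unfolding Z_def by (rule resolution_Z_presheaf)
  interpret G: module field_ring "sect (resolution X P (Suc n)) U" using U by (rule module_resolution)
  have N: "submodule (germs X Z U ` carrier (sect Z U)) field_ring (sect (resolution X P (Suc n)) U)"
    using Z.germs_image_submodule[OF U] by (simp add: resolution_def Z_def)
  define W where "W = resolution_Z X P n"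
  interpret W: vector_space_presheaf X W unfolding W_def by (rule resolution_Z_presheaf)
  interpret Q: vector_space_presheaf X "godement_quot X W"
    by (rule W.vector_space_presheaf_godement_quot)
  have "germs X W U ` carrier (sect W U) +>\<^bsub>sect (resolution X P n) U\<^esub> s \<in> carrier (sect (godement_quot X W) U)"
    using s unfolding resolution_def W_def[symmetric] W.sect_godement_quot carrier_quot_module by blast
  hence "germs X (godement_quot X W) U (germs X W U ` carrier (sect W U) +>\<^bsub>sect (resolution X P n) U\<^esub> s)
      \<in> carrier (sect (sheafify X (godement_quot X W)) U)"
    by (rule module_hom_closed[OF Q.germs_hom_sheafify[OF U]])
  hence mem: "resolution_diff X P n U s \<in> germs X Z U ` carrier (sect Z U)"
    by (auto simp: resolution_diff_def Let_def Z_def W_def transport_presheaf_def transport_module_def)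
  have car: "resolution_diff X P n U s \<in> carrier (sect (resolution X P (Suc n)) U)"
    by (rule module_hom_closed[OF resolution_diff_hom[OF U] s])
  have "germs X Z U ` carrier (sect Z U) +>\<^bsub>sect (resolution X P (Suc n)) U\<^esub> resolution_diff X P n U s
      = germs X Z U ` carrier (sect Z U) +>\<^bsub>sect (resolution X P (Suc n)) U\<^esub> \<zero>\<^bsub>sect (resolution X P (Suc n)) U\<^esub>"
    using G.zero_coset[OF N car] G.zero_coset[OF N G.M.zero_closed] mem
      submodule.axioms(1)[OF N, THEN subgroup.one_closed] by simp
  hence "resolution_diff X P (Suc n) U (resolution_diff X P n U s)
      = resolution_diff X P (Suc n) U \<zero>\<^bsub>sect (resolution X P (Suc n)) U\<^esub>"
    by (simp only: resolution_diff_def[of X P "Suc n"] Let_def Z_def)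
  also have "\<dots> = \<zero>\<^bsub>sect (resolution X P (Suc (Suc n))) U\<^esub>"
    by (rule module_hom_zero[OF module_resolution[OF U] module_resolution[OF U] resolution_diff_hom[OF U]])
  finally show ?thesis .
qed

end

subsection \<open>The morphism induced by zero\<close>

text \<open>
  A morphism whose components vanish on open sets need not be constant as a function, because the zero
  section depends on the open set. That it induces the zero morphism at every stage of the resolution is
  therefore traced through the constructions one at a time.
\<close>

lemma germs_map_zero:
  assumes P: "vector_space_presheaf X P" and Q: "vector_space_presheaf X Q"
    and f: "\<And>V t. openin X V \<Longrightarrow> t \<in> carrier (sect P V) \<Longrightarrow> f V t = \<zero>\<^bsub>sect Q V\<^esub>"
    and s: "s \<in> carrier (sect (godement X P) U)"
  shows "germs_map X Q f U s = \<zero>\<^bsub>sect (godement X Q) U\<^esub>"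
proof -
  interpret P: vector_space_presheaf X P by fact
  interpret Q: vector_space_presheaf X Q by fact
  have "(\<Union>(V, t)\<in>s x. germ X Q x V (f V t)) = \<zero>\<^bsub>stalk X Q x\<^esub>" if "x \<in> U" for x
  proof -
    have sx: "s x \<in> carrier (stalk X P x)" using s that by (auto simp: godement_def prod_module_def)
    obtain V t where "(V, t) \<in> s x" using P.stalk_nonempty[OF sx] by fastforce
    thus ?thesis
    proof (rule UN_pair_eqI)
      fix W u assume "(W, u) \<in> s x"
      thus "germ X Q x W (f W u) = \<zero>\<^bsub>stalk X Q x\<^esub>"
        using P.stalk_memD[OF sx] f by (simp add: Q.stalk_zero[symmetric])
    qed
  qed
  thus ?thesis by (auto simp: germs_map_def godement_def prod_module_def intro!: restrict_ext)
qed

lemma godement_quot_map_zero: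
  assumes P: "vector_space_presheaf X P" and Q: "vector_space_presheaf X Q"
    and f: "\<And>V t. openin X V \<Longrightarrow> t \<in> carrier (sect P V) \<Longrightarrow> f V t = \<zero>\<^bsub>sect Q V\<^esub>"
    and U: "openin X U" and A: "A \<in> carrier (sect (godement_quot X P) U)"
  shows "godement_quot_map X Q f U A = \<zero>\<^bsub>sect (godement_quot X Q) U\<^esub>"
proof -
  interpret P: vector_space_presheaf X P by fact
  interpret Q: vector_space_presheaf X Q by fact
  interpret G: module field_ring "sect (godement X Q) U"
    by (rule vector_space_presheaf.module[OF Q.vector_space_presheaf_godement U])
  let ?N = "germs X Q U ` carrier (sect Q U)"
  have "?N +>\<^bsub>sect (godement X Q) U\<^esub> germs_map X Q f U a = ?N" if "a \<in> A" for a
    using P.godement_quot_mem(2)[OF U A that] G.zero_coset[OF Q.germs_image_submodule[OF U] G.M.zero_closed]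
      submodule.axioms(1)[OF Q.germs_image_submodule[OF U], THEN subgroup.one_closed]
    by (simp add: germs_map_zero[OF P Q f])
  thus ?thesis
    using P.godement_quot_mem(1)[OF U A]
    by (auto simp: godement_quot_map_def Q.sect_godement_quot quot_module_def)
qed

lemma resolution_Z_map_zero:
  assumes P: "vector_space_presheaf X P" and Q: "vector_space_presheaf X Q"
    and f: "\<And>V t. openin X V \<Longrightarrow> t \<in> carrier (sect P V) \<Longrightarrow> f V t = \<zero>\<^bsub>sect Q V\<^esub>"
    and U: "openin X U" and a: "a \<in> carrier (sect (resolution_Z X P n) U)"
  shows "resolution_Z_map X P Q f n U a = \<zero>\<^bsub>sect (resolution_Z X Q n) U\<^esub>"
  using U a
proof (induction n arbitrary: U a)
  case 0
  have "inv_into (carrier (sect P U)) Base a \<in> carrier (sect P U)"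
    using 0(2) by (auto simp: transport_presheaf_def transport_module_def Let_def intro: inv_into_into)
  thus ?case
    using f[OF 0(1)] by (simp add: transport_map_def transport_presheaf_def transport_module_def Let_def)
next
  case (Suc n)
  define Z where "Z = resolution_Z X P n"
  define W where "W = resolution_Z X Q n"
  interpret Z: vector_space_presheaf X Z
    unfolding Z_def using P by (rule vector_space_presheaf.resolution_Z_presheaf)
  interpret W: vector_space_presheaf X W
    unfolding W_def using Q by (rule vector_space_presheaf.resolution_Z_presheaf)
  let ?f = "godement_quot_map X W (resolution_Z_map X P Q f n)"
  have "inv_into (carrier (sect (sheafify X (godement_quot X Z)) U)) encode a
      \<in> carrier (sect (sheafify X (godement_quot X Z)) U)"
    using Suc.prems(2)
    by (auto simp: Z_def transport_presheaf_def transport_module_def Let_def intro: inv_into_into)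
  hence "inv_into (carrier (sect (sheafify X (godement_quot X Z)) U)) encode a
      \<in> carrier (sect (godement X (godement_quot X Z)) U)"
    by (auto simp: sheafify_def)
  hence "germs_map X (godement_quot X W) ?f U (inv_into (carrier (sect (sheafify X (godement_quot X Z)) U)) encode a)
      = \<zero>\<^bsub>sect (godement X (godement_quot X W)) U\<^esub>"
    using Suc.IH
    by (intro germs_map_zero[OF Z.vector_space_presheaf_godement_quot W.vector_space_presheaf_godement_quot]
        godement_quot_map_zero[OF Z.vector_space_presheaf_axioms W.vector_space_presheaf_axioms])
      (auto simp: Z_def W_def)
  thus ?case
    by (simp add: transport_map_def Z_def W_def transport_presheaf_def transport_module_def Let_def sheafify_def)
qed

lemma resolution_map_zero:
  assumes P: "vector_space_presheaf X P" and Q: "vector_space_presheaf X Q"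
    and f: "\<And>V t. openin X V \<Longrightarrow> t \<in> carrier (sect P V) \<Longrightarrow> f V t = \<zero>\<^bsub>sect Q V\<^esub>"
    and s: "s \<in> carrier (sect (resolution X P n) U)"
  shows "resolution_map X P Q f n U s = \<zero>\<^bsub>sect (resolution X Q n) U\<^esub>"
  unfolding resolution_map_def resolution_def
proof (rule germs_map_zero)
  show "resolution_Z_map X P Q f n V t = \<zero>\<^bsub>sect (resolution_Z X Q n) V\<^esub>"
    if "openin X V" "t \<in> carrier (sect (resolution_Z X P n) V)" for V t
    using resolution_Z_map_zero[OF P Q, of f, OF f that] by simp
  show "s \<in> carrier (sect (godement X (resolution_Z X P n)) U)"
    using s by (simp add: resolution_def)
qed (intro vector_space_presheaf.resolution_Z_presheaf P Q)+

section \<open>Exterior powers\<close>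

text \<open>
  The support of a sum lies in the union of the supports, and that of a multiple in the given support.
\<close>

lemma module_free_module:
  assumes "cring R"
  shows "module R (free_module R B)"
proof -
  interpret R: cring R by fact
  let ?supp = "\<lambda>\<phi>. {b. \<phi> b \<noteq> \<zero>\<^bsub>R\<^esub>}"
  have I: "\<phi> \<in> carrier (free_module R B)"
    if "\<And>b. \<phi> b \<in> carrier R" "?supp \<phi> \<subseteq> S" "finite S" "S \<subseteq> B" for \<phi> :: "'c \<Rightarrow> 'a" and S
    using that finite_subset[OF that(2,3)] by (auto simp: free_module_def)
  have E: "\<phi> b \<in> carrier R" "?supp \<phi> \<subseteq> B" "finite (?supp \<phi>)"
    if "\<phi> \<in> carrier (free_module R B)" for \<phi> b
    using that by (auto simp: free_module_def)
  have op: "\<phi> \<oplus>\<^bsub>free_module R B\<^esub> \<psi> = (\<lambda>b. \<phi> b \<oplus>\<^bsub>R\<^esub> \<psi> b)" "r \<odot>\<^bsub>free_module R B\<^esub> \<phi> = (\<lambda>b. r \<otimes>\<^bsub>R\<^esub> \<phi> b)"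
    "\<zero>\<^bsub>free_module R B\<^esub> = (\<lambda>_. \<zero>\<^bsub>R\<^esub>)" for \<phi> \<psi> r
    by (simp_all add: free_module_def)
  have add: "\<phi> \<oplus>\<^bsub>free_module R B\<^esub> \<psi> \<in> carrier (free_module R B)"
    if "\<phi> \<in> carrier (free_module R B)" "\<psi> \<in> carrier (free_module R B)" for \<phi> \<psi>
    using E[OF that(1)] E[OF that(2)]
    by (intro I[of _ "?supp \<phi> \<union> ?supp \<psi>"]) (auto simp: op)
  have smult: "r \<odot>\<^bsub>free_module R B\<^esub> \<phi> \<in> carrier (free_module R B)"
    if "r \<in> carrier R" "\<phi> \<in> carrier (free_module R B)" for \<phi> r
    using E[OF that(2)] that(1) by (intro I[of _ "?supp \<phi>"]) (auto simp: op)
  show ?thesis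
  proof (rule moduleI)
    show "abelian_group (free_module R B)"
    proof (rule abelian_groupI)
      show "\<zero>\<^bsub>free_module R B\<^esub> \<in> carrier (free_module R B)" by (simp add: free_module_def)
      fix \<phi> assume \<phi>: "\<phi> \<in> carrier (free_module R B)"
      show "\<exists>\<psi>\<in>carrier (free_module R B). \<psi> \<oplus>\<^bsub>free_module R B\<^esub> \<phi> = \<zero>\<^bsub>free_module R B\<^esub>"
        using E[OF \<phi>]
        by (intro bexI[of _ "\<lambda>b. \<ominus>\<^bsub>R\<^esub> \<phi> b"] I[of _ "?supp \<phi>"]) (auto simp: op R.l_neg)
    qed (use E in \<open>auto simp: add[unfolded op] op fun_eq_iff R.a_ac\<close>)
  qed (use E in \<open>auto simp: smult[unfolded op] op fun_eq_iff R.l_distr R.r_distr R.m_assoc R.cring_axioms\<close>)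
qed

lemma free_gen_closed: "cring R \<Longrightarrow> b \<in> B \<Longrightarrow> free_gen R b \<in> carrier (free_module R B)"
  using cring.cring_simprules[of R]
  by (auto simp: free_module_def free_gen_def intro: finite_subset[of _ "{b}"] split: if_splits)

lemma tuples_iff: "l \<in> tuples i A \<longleftrightarrow> set l \<subseteq> A \<and> length l = i"
  by (auto simp: tuples_def)

lemma exterior_generators_add:
  "us @ a # vs \<in> tuples i (carrier M) \<Longrightarrow> b \<in> carrier M \<Longrightarrow>
    free_gen R (us @ (a \<oplus>\<^bsub>M\<^esub> b) # vs) \<ominus>\<^bsub>free_module R (tuples i (carrier M))\<^esub>
      (free_gen R (us @ a # vs) \<oplus>\<^bsub>free_module R (tuples i (carrier M))\<^esub> free_gen R (us @ b # vs))
    \<in> exterior_generators R M i"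
  unfolding exterior_generators_def Let_def by blast

lemma exterior_generators_smult:
  "us @ a # vs \<in> tuples i (carrier M) \<Longrightarrow> r \<in> carrier R \<Longrightarrow>
    free_gen R (us @ (r \<odot>\<^bsub>M\<^esub> a) # vs) \<ominus>\<^bsub>free_module R (tuples i (carrier M))\<^esub>
      r \<odot>\<^bsub>free_module R (tuples i (carrier M))\<^esub> free_gen R (us @ a # vs)
    \<in> exterior_generators R M i"
  unfolding exterior_generators_def Let_def by blast

lemma exterior_generators_alternating:
  "us @ a # vs @ a # ws \<in> tuples i (carrier M) \<Longrightarrow>
    free_gen R (us @ a # vs @ a # ws) \<in> exterior_generators R M i"
  unfolding exterior_generators_def Let_def by blast

lemma exterior_generatorsE:
  assumes "g \<in> exterior_generators R M i"
  obtains (add) us a b vs where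
      "g = free_gen R (us @ (a \<oplus>\<^bsub>M\<^esub> b) # vs) \<ominus>\<^bsub>free_module R (tuples i (carrier M))\<^esub>
        (free_gen R (us @ a # vs) \<oplus>\<^bsub>free_module R (tuples i (carrier M))\<^esub> free_gen R (us @ b # vs))"
      "us @ a # vs \<in> tuples i (carrier M)" "b \<in> carrier M"
  | (smult) us r a vs where
      "g = free_gen R (us @ (r \<odot>\<^bsub>M\<^esub> a) # vs) \<ominus>\<^bsub>free_module R (tuples i (carrier M))\<^esub>
        r \<odot>\<^bsub>free_module R (tuples i (carrier M))\<^esub> free_gen R (us @ a # vs)"
      "us @ a # vs \<in> tuples i (carrier M)" "r \<in> carrier R"
  | (alternating) us a vs ws where
      "g = free_gen R (us @ a # vs @ a # ws)" "us @ a # vs @ a # ws \<in> tuples i (carrier M)"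
  using assms unfolding exterior_generators_def Let_def by blast

lemma exterior_generators_subset:
  assumes "module R M"
  shows "exterior_generators R M i \<subseteq> carrier (free_module R (tuples i (carrier M)))"
proof -
  interpret M: module R M by fact
  have L: "module R (free_module R (tuples i (carrier M)))" for i
    by (rule module_free_module) (rule M.R.cring_axioms)
  note ab = module.axioms(2)[OF L]
  note gen = free_gen_closed[OF M.R.cring_axioms]
  show ?thesis
    by (auto simp: exterior_generators_def Let_def tuples_iff
        intro!: abelian_group.minus_closed[OF ab] abelian_monoid.a_closed[OF abelian_group.axioms(1)[OF ab]]
          module.smult_closed[OF L] gen)
qed

lemma exterior_relations_submodule:
  assumes "module R M"
  shows "submodule (exterior_relations R M i) R (free_module R (tuples i (carrier M)))"
proof -
  interpret M: module R M by fact
  let ?L = "free_module R (tuples i (carrier M))"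
  interpret L: module R ?L by (rule module_free_module) (rule M.R.cring_axioms)
  have c: "submodule (carrier ?L) R ?L" by (rule L.carrier_is_submodule)
  show ?thesis
    unfolding exterior_relations_def hull_def
  proof (rule L.submoduleI_without_inverses)
    show "\<Inter>{t. submodule t R ?L \<and> exterior_generators R M i \<subseteq> t} \<subseteq> carrier ?L"
      using c exterior_generators_subset[OF assms] by blast
    show "\<zero>\<^bsub>?L\<^esub> \<in> \<Inter>{t. submodule t R ?L \<and> exterior_generators R M i \<subseteq> t}"
      using submodule.axioms(1)[THEN subgroup.one_closed] by fastforce
  qed (simp_all add: L.submoduleE(4,5))
qed

text \<open>
  Cosets depend only on the addition, so restricting the scalars to the constants commutes with taking
  quotients. The exterior presheaf over the varying rings \<open>\<O> U\<close> thus becomes a quotient of presheaves of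
  vector spaces.
\<close>

lemma underlying_quot_presheaf:
  "underlying_vector_spaces (quot_presheaf P N) = quot_presheaf (underlying_vector_spaces P) N"
  by (simp add: underlying_vector_spaces_def quot_presheaf_def quot_module_def restrict_scalars_def
      A_RCOSETS_def' set_add_def' a_r_coset_def' fun_eq_iff)

locale a_space_module = A: a_space X T \<O> + F: sheaf_of_modules X \<O> F
  for X :: "'x topology" and T :: "'k::field_char_0 topology" and \<O> :: "'x set \<Rightarrow> ('x \<Rightarrow> 'k) set"
    and F :: "('x, 'x \<Rightarrow> 'k, 'a) presheaf"
begin

lemma carrier_function_ring: "carrier (function_ring \<O> U) = \<O> U"
  by (simp add: function_ring_def)

lemma cring_function_ring:
  assumes U: "openin X U"
  shows "cring (function_ring \<O> U)"
proof (rule cringI)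
  show "abelian_group (function_ring \<O> U)"
  proof (rule abelian_groupI)
    fix f assume f: "f \<in> carrier (function_ring \<O> U)"
    have "(\<lambda>x\<in>U. (\<lambda>x\<in>U. -1) x * f x) \<in> \<O> U"
      using f U by (intro A.mult_closed A.const_closed) (auto simp: function_ring_def)
    moreover have "(\<lambda>x\<in>U. (\<lambda>x\<in>U. -1) x * f x) \<oplus>\<^bsub>function_ring \<O> U\<^esub> f = \<zero>\<^bsub>function_ring \<O> U\<^esub>"
      by (auto simp: function_ring_def intro!: restrict_ext)
    ultimately show "\<exists>g\<in>carrier (function_ring \<O> U). g \<oplus>\<^bsub>function_ring \<O> U\<^esub> f = \<zero>\<^bsub>function_ring \<O> U\<^esub>"
      unfolding carrier_function_ring by blast
    show "\<zero>\<^bsub>function_ring \<O> U\<^esub> \<oplus>\<^bsub>function_ring \<O> U\<^esub> f = f"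
      using f by (simp add: function_ring_def A.extensional[OF U] extensional_restrict cong: restrict_cong)
  qed (auto simp: function_ring_def A.const_closed A.add_closed U add_ac fun_eq_iff)
  show "Group.comm_monoid (function_ring \<O> U)"
  proof (rule comm_monoidI)
    fix f assume "f \<in> carrier (function_ring \<O> U)"
    thus "\<one>\<^bsub>function_ring \<O> U\<^esub> \<otimes>\<^bsub>function_ring \<O> U\<^esub> f = f"
      by (simp add: function_ring_def A.extensional[OF U] extensional_restrict cong: restrict_cong)
  qed (auto simp: function_ring_def A.const_closed A.mult_closed U mult_ac fun_eq_iff)
qed (auto simp: function_ring_def algebra_simps fun_eq_iff)

lemma const_ring_hom:
  assumes U: "openin X U"
  shows "(\<lambda>c. \<lambda>x\<in>U. c) \<in> ring_hom field_ring (function_ring \<O> U)"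
  by (rule ring_hom_memI) (auto simp: function_ring_def field_ring_def A.const_closed U intro!: restrict_ext)

text \<open>
  Sums in the ring of functions are pointwise, so that identities for the restriction of formal
  combinations reduce to identities for finite sums in the field.
\<close>

lemma finsum_function_ring:
  assumes U: "openin X U" and "finite A" and "\<And>l. l \<in> A \<Longrightarrow> f l \<in> \<O> U"
  shows "finsum (function_ring \<O> U) f A = (\<lambda>x\<in>U. \<Sum>l\<in>A. f l x)"
proof -
  interpret R: cring "function_ring \<O> U" using U by (rule cring_function_ring)
  show ?thesis
    using assms(2,3)
  proof (induction A rule: finite_induct)
    case empty
    show ?case unfolding R.finsum_empty by (simp add: function_ring_def)
  next
    case (insert l A)
    have "finsum (function_ring \<O> U) f (insert l A) = f l \<oplus>\<^bsub>function_ring \<O> U\<^esub> finsum (function_ring \<O> U) f A"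
      using insert by (intro R.finsum_insert) (auto simp: carrier_function_ring)
    thus ?case using insert by (auto simp: function_ring_def intro!: restrict_ext)
  qed
qed

abbreviation "free_sections i U \<equiv> free_module (function_ring \<O> U) (tuples i (carrier (sect F U)))"

lemma module_free_sections: "openin X U \<Longrightarrow> module (function_ring \<O> U) (free_sections i U)"
  by (intro module_free_module cring_function_ring)

lemma free_moduleD:
  assumes "\<phi> \<in> carrier (free_sections i U)"
  shows "\<phi> l \<in> \<O> U" "\<phi> l \<noteq> \<zero>\<^bsub>function_ring \<O> U\<^esub> \<Longrightarrow> l \<in> tuples i (carrier (sect F U))"
    "finite {l. \<phi> l \<noteq> \<zero>\<^bsub>function_ring \<O> U\<^esub>}"
  using assms by (auto simp: free_module_def function_ring_def)

lemma free_sections_apply: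
  "(\<phi> \<oplus>\<^bsub>free_sections i U\<^esub> \<psi>) l = (\<lambda>x\<in>U. \<phi> l x + \<psi> l x)" "(f \<odot>\<^bsub>free_sections i U\<^esub> \<phi>) l = (\<lambda>x\<in>U. f x * \<phi> l x)"
  by (simp_all add: free_module_def function_ring_def)

lemma map_res_tuples:
  assumes "openin X U" "openin X V" "V \<subseteq> U" "l \<in> tuples i (carrier (sect F U))"
  shows "map (res F U V) l \<in> tuples i (carrier (sect F V))"
  using assms by (auto simp: tuples_iff F.res_closed)

text \<open>
  The sum defining the restriction runs over those elements of the support that restrict to \<open>m\<close>.
  Extending it by zero to a set \<open>S\<close> that does not depend on \<open>m\<close> allows sums for several combinations,
  or for several \<open>m\<close>, to be taken over the same set.
\<close>

lemma res_free_eq: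
  assumes U: "openin X U" and V: "openin X V" "V \<subseteq> U" and \<phi>: "\<phi> \<in> carrier (free_sections i U)"
    and S: "finite S" "{l. \<phi> l \<noteq> \<zero>\<^bsub>function_ring \<O> U\<^esub>} \<subseteq> S"
  shows "res (free_presheaf \<O> F i) U V \<phi> m
    = (\<lambda>x\<in>V. \<Sum>l\<in>S. if map (res F U V) l = m then \<phi> l x else 0)"
proof -
  let ?A = "{l. \<phi> l \<noteq> \<zero>\<^bsub>function_ring \<O> U\<^esub> \<and> map (res F U V) l = m}"
  have fin: "finite ?A" using S by (auto intro: finite_subset)
  have "res (free_presheaf \<O> F i) U V \<phi> m = (\<lambda>x\<in>V. \<Sum>l\<in>?A. restrict (\<phi> l) V x)"
    using finsum_function_ring[OF V(1) fin, of "\<lambda>l. restrict (\<phi> l) V"]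
      A.restrict_closed[OF U V free_moduleD(1)[OF \<phi>]]
    by (simp add: free_presheaf_def)
  also have "\<dots> = (\<lambda>x\<in>V. \<Sum>l\<in>S. if map (res F U V) l = m then \<phi> l x else 0)"
  proof (rule restrict_ext)
    fix x assume x: "x \<in> V"
    have "(\<Sum>l\<in>?A. restrict (\<phi> l) V x) = (\<Sum>l\<in>?A. if map (res F U V) l = m then \<phi> l x else 0)"
      using x by (intro sum.cong) auto
    also have "\<dots> = (\<Sum>l\<in>S. if map (res F U V) l = m then \<phi> l x else 0)"
      using S x V(2) by (intro sum.mono_neutral_left) (auto simp: function_ring_def)
    finally show "(\<Sum>l\<in>?A. restrict (\<phi> l) V x) = (\<Sum>l\<in>S. if map (res F U V) l = m then \<phi> l x else 0)" .
  qed
  finally show ?thesis .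
qed

lemma res_free_support:
  assumes U: "openin X U" and V: "openin X V" "V \<subseteq> U" and \<phi>: "\<phi> \<in> carrier (free_sections i U)"
  shows "{m. res (free_presheaf \<O> F i) U V \<phi> m \<noteq> \<zero>\<^bsub>function_ring \<O> V\<^esub>}
    \<subseteq> map (res F U V) ` {l. \<phi> l \<noteq> \<zero>\<^bsub>function_ring \<O> U\<^esub>}"
proof
  let ?S = "{l. \<phi> l \<noteq> \<zero>\<^bsub>function_ring \<O> U\<^esub>}"
  fix m assume m: "m \<in> {m. res (free_presheaf \<O> F i) U V \<phi> m \<noteq> \<zero>\<^bsub>function_ring \<O> V\<^esub>}"
  show "m \<in> map (res F U V) ` ?S"
  proof (rule ccontr)
    assume "m \<notin> map (res F U V) ` ?S"
    hence "(\<Sum>l\<in>?S. if map (res F U V) l = m then \<phi> l x else 0) = 0" for x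
      by (intro sum.neutral) auto
    thus False
      using m res_free_eq[OF assms free_moduleD(3)[OF \<phi>] order_refl, of m]
      by (simp add: function_ring_def)
  qed
qed

lemma res_free_closed:
  assumes U: "openin X U" and V: "openin X V" "V \<subseteq> U" and \<phi>: "\<phi> \<in> carrier (free_sections i U)"
  shows "res (free_presheaf \<O> F i) U V \<phi> \<in> carrier (free_sections i V)"
proof -
  interpret R: cring "function_ring \<O> V" using V(1) by (rule cring_function_ring)
  let ?r = "res (free_presheaf \<O> F i) U V \<phi>"
  have "?r m \<in> carrier (function_ring \<O> V)" for m
    using A.restrict_closed[OF U V free_moduleD(1)[OF \<phi>]]
    by (auto simp: free_presheaf_def function_ring_def intro!: R.finsum_closed[unfolded function_ring_def, simplified])
  moreover have "{m. ?r m \<noteq> \<zero>\<^bsub>function_ring \<O> V\<^esub>} \<subseteq> tuples i (carrier (sect F V))"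
    using res_free_support[OF assms] map_res_tuples[OF U V] free_moduleD(2)[OF \<phi>] by fast
  moreover have "finite {m. ?r m \<noteq> \<zero>\<^bsub>function_ring \<O> V\<^esub>}"
    using finite_subset[OF res_free_support[OF assms]] free_moduleD(3)[OF \<phi>] by blast
  ultimately show ?thesis by (simp add: free_module_def)
qed

lemma res_free_add:
  assumes U: "openin X U" and V: "openin X V" "V \<subseteq> U"
    and \<phi>: "\<phi> \<in> carrier (free_sections i U)" and \<psi>: "\<psi> \<in> carrier (free_sections i U)"
  shows "res (free_presheaf \<O> F i) U V (\<phi> \<oplus>\<^bsub>free_sections i U\<^esub> \<psi>)
    = res (free_presheaf \<O> F i) U V \<phi> \<oplus>\<^bsub>free_sections i V\<^esub> res (free_presheaf \<O> F i) U V \<psi>"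
proof
  fix m
  interpret L: module "function_ring \<O> U" "free_sections i U" using U by (rule module_free_sections)
  let ?S = "{l. \<phi> l \<noteq> \<zero>\<^bsub>function_ring \<O> U\<^esub>} \<union> {l. \<psi> l \<noteq> \<zero>\<^bsub>function_ring \<O> U\<^esub>}"
  have fin: "finite ?S" using free_moduleD(3)[OF \<phi>] free_moduleD(3)[OF \<psi>] by simp
  have sub: "{l. (\<phi> \<oplus>\<^bsub>free_sections i U\<^esub> \<psi>) l \<noteq> \<zero>\<^bsub>function_ring \<O> U\<^esub>} \<subseteq> ?S"
    by (auto simp: free_module_def function_ring_def)
  show "res (free_presheaf \<O> F i) U V (\<phi> \<oplus>\<^bsub>free_sections i U\<^esub> \<psi>) m
    = (res (free_presheaf \<O> F i) U V \<phi> \<oplus>\<^bsub>free_sections i V\<^esub> res (free_presheaf \<O> F i) U V \<psi>) m"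
    unfolding free_sections_apply res_free_eq[OF U V L.M.a_closed[OF \<phi> \<psi>] fin sub]
      res_free_eq[OF U V \<phi> fin Un_upper1] res_free_eq[OF U V \<psi> fin Un_upper2]
    using V(2) by (auto simp: sum.distrib[symmetric] subset_iff intro!: restrict_ext sum.cong)
qed

lemma res_free_smult:
  assumes U: "openin X U" and V: "openin X V" "V \<subseteq> U"
    and \<phi>: "\<phi> \<in> carrier (free_sections i U)" and f: "f \<in> \<O> U"
  shows "res (free_presheaf \<O> F i) U V (f \<odot>\<^bsub>free_sections i U\<^esub> \<phi>)
    = restrict f V \<odot>\<^bsub>free_sections i V\<^esub> res (free_presheaf \<O> F i) U V \<phi>"
proof
  fix m
  interpret L: module "function_ring \<O> U" "free_sections i U" using U by (rule module_free_sections)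
  let ?S = "{l. \<phi> l \<noteq> \<zero>\<^bsub>function_ring \<O> U\<^esub>}"
  note fin = free_moduleD(3)[OF \<phi>]
  have c: "f \<odot>\<^bsub>free_sections i U\<^esub> \<phi> \<in> carrier (free_sections i U)"
    using f \<phi> by (intro L.smult_closed) (simp_all add: function_ring_def)
  have sub: "{l. (f \<odot>\<^bsub>free_sections i U\<^esub> \<phi>) l \<noteq> \<zero>\<^bsub>function_ring \<O> U\<^esub>} \<subseteq> ?S"
    by (auto simp: free_module_def function_ring_def)
  show "res (free_presheaf \<O> F i) U V (f \<odot>\<^bsub>free_sections i U\<^esub> \<phi>) m
    = (restrict f V \<odot>\<^bsub>free_sections i V\<^esub> res (free_presheaf \<O> F i) U V \<phi>) m"
    unfolding free_sections_apply res_free_eq[OF U V c fin sub] res_free_eq[OF U V \<phi> fin order_refl]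
    using V(2) by (auto simp: sum_distrib_left subset_iff intro!: restrict_ext sum.cong)
qed

lemma res_free_gen:
  assumes U: "openin X U" and V: "openin X V" "V \<subseteq> U" and l: "l \<in> tuples i (carrier (sect F U))"
  shows "res (free_presheaf \<O> F i) U V (free_gen (function_ring \<O> U) l)
    = free_gen (function_ring \<O> V) (map (res F U V) l)"
proof
  fix m
  have sub: "{l'. free_gen (function_ring \<O> U) l l' \<noteq> \<zero>\<^bsub>function_ring \<O> U\<^esub>} \<subseteq> {l}"
    by (auto simp: free_gen_def)
  show "res (free_presheaf \<O> F i) U V (free_gen (function_ring \<O> U) l) m
    = free_gen (function_ring \<O> V) (map (res F U V) l) m"
    using V(2) by (subst res_free_eq[OF U V free_gen_closed[OF cring_function_ring[OF U] l] _ sub])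
      (auto simp: free_gen_def function_ring_def intro!: restrict_ext)
qed

lemma res_free_id:
  assumes U: "openin X U" and \<phi>: "\<phi> \<in> carrier (free_sections i U)"
  shows "res (free_presheaf \<O> F i) U U \<phi> = \<phi>"
proof
  fix m
  let ?S = "{l. \<phi> l \<noteq> \<zero>\<^bsub>function_ring \<O> U\<^esub>}"
  have "map (res F U U) l = l" if "l \<in> ?S" for l
    using free_moduleD(2)[OF \<phi>, of l] that by (intro map_idI) (auto simp: tuples_iff F.res_id U)
  hence "(\<Sum>l\<in>?S. if map (res F U U) l = m then \<phi> l x else 0) = (\<Sum>l\<in>?S. if l = m then \<phi> l x else 0)" for x
    by (intro sum.cong) auto
  also have "(\<Sum>l\<in>?S. if l = m then \<phi> l x else 0) = \<phi> m x" if "x \<in> U" for x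
    using that free_moduleD(3)[OF \<phi>] by (simp add: function_ring_def)
  finally have "(\<lambda>x\<in>U. \<Sum>l\<in>?S. if map (res F U U) l = m then \<phi> l x else 0) = restrict (\<phi> m) U"
    by (intro restrict_ext) auto
  thus "res (free_presheaf \<O> F i) U U \<phi> m = \<phi> m"
    using res_free_eq[OF U U order_refl \<phi> free_moduleD(3)[OF \<phi>] order_refl, of m]
      A.extensional[OF U free_moduleD(1)[OF \<phi>, of m]] by (simp add: extensional_restrict)
qed

text \<open>
  Restricting twice groups the sum over the support by the restrictions to the intermediate open set.
\<close>

lemma res_free_res:
  assumes U: "openin X U" and V: "openin X V" "V \<subseteq> U" and W: "openin X W" "W \<subseteq> V"
    and \<phi>: "\<phi> \<in> carrier (free_sections i U)"
  shows "res (free_presheaf \<O> F i) V W (res (free_presheaf \<O> F i) U V \<phi>) = res (free_presheaf \<O> F i) U W \<phi>"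
proof
  fix m
  let ?S = "{l. \<phi> l \<noteq> \<zero>\<^bsub>function_ring \<O> U\<^esub>}"
  let ?S' = "map (res F U V) ` ?S"
  have WU: "W \<subseteq> U" using V W by auto
  note fin = free_moduleD(3)[OF \<phi>]
  have fin': "finite ?S'" using fin by simp
  have comp: "map (res F V W) (map (res F U V) l) = map (res F U W) l" if "l \<in> ?S" for l
    using free_moduleD(2)[OF \<phi>, of l] that U V W by (auto simp: tuples_iff F.res_res)
  have "(\<Sum>l'\<in>?S'. if map (res F V W) l' = m then (\<Sum>l\<in>?S. if map (res F U V) l = l' then \<phi> l x else 0) else 0)
      = (\<Sum>l\<in>?S. if map (res F U W) l = m then \<phi> l x else 0)" for x
  proof -
    have "(\<Sum>l'\<in>?S'. if map (res F V W) l' = m then (\<Sum>l\<in>?S. if map (res F U V) l = l' then \<phi> l x else 0) else 0)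
      = (\<Sum>l'\<in>?S'. \<Sum>l\<in>?S. if map (res F U V) l = l' then (if map (res F V W) l' = m then \<phi> l x else 0) else 0)"
      by (intro sum.cong) (auto intro!: sum.cong sum.neutral)
    also have "\<dots> = (\<Sum>l\<in>?S. \<Sum>l'\<in>?S'. if map (res F U V) l = l' then (if map (res F V W) l' = m then \<phi> l x else 0) else 0)"
      by (rule sum.swap)
    also have "\<dots> = (\<Sum>l\<in>?S. if map (res F U W) l = m then \<phi> l x else 0)"
      using fin' comp by (intro sum.cong) (simp_all add: sum.delta del: map_map)
    finally show ?thesis .
  qed
  note eq = this
  show "res (free_presheaf \<O> F i) V W (res (free_presheaf \<O> F i) U V \<phi>) m = res (free_presheaf \<O> F i) U W \<phi> m"
    unfolding res_free_eq[OF V(1) W res_free_closed[OF U V \<phi>] fin' res_free_support[OF U V \<phi>]]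
      res_free_eq[OF U V \<phi> fin order_refl] res_free_eq[OF U W(1) WU \<phi> fin order_refl]
    using W(2) by (auto intro!: restrict_ext simp: eq[symmetric] intro!: sum.cong)
qed

lemma vector_space_presheaf_free: "vector_space_presheaf X (underlying_vector_spaces (free_presheaf \<O> F i))"
proof (rule vector_space_presheaf.intro)
  have sect: "sect (underlying_vector_spaces (free_presheaf \<O> F i)) U = restrict_scalars (\<lambda>c. \<lambda>x\<in>U. c) (free_sections i U)" for U
    by (simp add: underlying_vector_spaces_def free_presheaf_def)
  have res: "res (underlying_vector_spaces (free_presheaf \<O> F i)) = res (free_presheaf \<O> F i)"
    by (simp add: underlying_vector_spaces_def)
  have car: "carrier (restrict_scalars h M) = carrier M" for h and M :: "('c, 'd) module"
    by (simp add: restrict_scalars_def)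
  show "module field_ring (sect (underlying_vector_spaces (free_presheaf \<O> F i)) U)" if "openin X U" for U
    unfolding sect by (intro module_restrict_scalars[OF module_free_sections cring_field_ring const_ring_hom] that)
  show "res (underlying_vector_spaces (free_presheaf \<O> F i)) U V
      \<in> module_hom field_ring (sect (underlying_vector_spaces (free_presheaf \<O> F i)) U)
          (sect (underlying_vector_spaces (free_presheaf \<O> F i)) V)"
    if o: "openin X U" "openin X V" "V \<subseteq> U" for U V
    unfolding sect res
  proof (rule module_homI)
    fix r :: 'k and \<phi> assume "\<phi> \<in> carrier (restrict_scalars (\<lambda>c. \<lambda>x\<in>U. c) (free_sections i U))"
    hence "\<phi> \<in> carrier (free_sections i U)" by (simp add: car)
    note res_free_smult[OF o this A.const_closed[OF o(1), of r]]
    moreover have "restrict (\<lambda>x\<in>U. r) V = (\<lambda>x\<in>V. r)" using o(3) by (auto simp: restrict_def fun_eq_iff)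
    ultimately show "res (free_presheaf \<O> F i) U V (r \<odot>\<^bsub>restrict_scalars (\<lambda>c. \<lambda>x\<in>U. c) (free_sections i U)\<^esub> \<phi>)
        = r \<odot>\<^bsub>restrict_scalars (\<lambda>c. \<lambda>x\<in>V. c) (free_sections i V)\<^esub> res (free_presheaf \<O> F i) U V \<phi>"
      by (simp add: restrict_scalars_def)
  qed (use o in \<open>simp_all add: restrict_scalars_def res_free_closed res_free_add\<close>)
  show "res (underlying_vector_spaces (free_presheaf \<O> F i)) U U \<phi> = \<phi>"
    if "openin X U" "\<phi> \<in> carrier (sect (underlying_vector_spaces (free_presheaf \<O> F i)) U)" for U \<phi>
    using res_free_id[OF that(1)] that(2) unfolding sect res car .
  show "res (underlying_vector_spaces (free_presheaf \<O> F i)) V W (res (underlying_vector_spaces (free_presheaf \<O> F i)) U V \<phi>)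
      = res (underlying_vector_spaces (free_presheaf \<O> F i)) U W \<phi>"
    if o: "openin X U" "openin X V" "openin X W" "W \<subseteq> V" "V \<subseteq> U"
      and "\<phi> \<in> carrier (sect (underlying_vector_spaces (free_presheaf \<O> F i)) U)" for U V W \<phi>
    using res_free_res[OF o(1,2,5,3,4)] that(6) unfolding sect res car .
qed

text \<open>
  The formal combinations that restrict to relations form a submodule, because restriction is
  semilinear along \<open>\<O> U \<rightarrow> \<O> V\<close>. It is therefore enough that each generator of the relations restricts
  to a generator of the same kind.
\<close>

lemma res_exterior_relations:
  assumes U: "openin X U" and V: "openin X V" "V \<subseteq> U"
  shows "res (free_presheaf \<O> F i) U V ` exterior_relations (function_ring \<O> U) (sect F U) i
    \<subseteq> exterior_relations (function_ring \<O> V) (sect F V) i"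
proof -
  interpret FU: module "function_ring \<O> U" "sect F U" using U by (rule F.module)
  interpret FV: module "function_ring \<O> V" "sect F V" using V(1) by (rule F.module)
  interpret LU: module "function_ring \<O> U" "free_sections i U" using U by (rule module_free_sections)
  interpret LV: module "function_ring \<O> V" "free_sections i V" using V(1) by (rule module_free_sections)
  let ?r = "res (free_presheaf \<O> F i) U V"
  let ?NV = "exterior_relations (function_ring \<O> V) (sect F V) i"
  have NV: "submodule ?NV (function_ring \<O> V) (free_sections i V)"
    by (rule exterior_relations_submodule) (rule FV.module_axioms)
  have gen: "exterior_generators (function_ring \<O> V) (sect F V) i \<subseteq> ?NV"
    unfolding exterior_relations_def by (rule hull_subset)
  define K where "K = {\<phi> \<in> carrier (free_sections i U). ?r \<phi> \<in> ?NV}"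
  have r_add: "?r (\<phi> \<oplus>\<^bsub>free_sections i U\<^esub> \<psi>) = ?r \<phi> \<oplus>\<^bsub>free_sections i V\<^esub> ?r \<psi>"
    if "\<phi> \<in> carrier (free_sections i U)" "\<psi> \<in> carrier (free_sections i U)" for \<phi> \<psi>
    using res_free_add[OF U V that] .
  have r_smult: "?r (f \<odot>\<^bsub>free_sections i U\<^esub> \<phi>) = restrict f V \<odot>\<^bsub>free_sections i V\<^esub> ?r \<phi>" "restrict f V \<in> carrier (function_ring \<O> V)"
    if "\<phi> \<in> carrier (free_sections i U)" "f \<in> carrier (function_ring \<O> U)" for f \<phi>
    using res_free_smult[OF U V that(1)] A.restrict_closed[OF U V] that(2)
    by (simp_all add: carrier_function_ring)
  have closed: "?r \<phi> \<in> carrier (free_sections i V)" if "\<phi> \<in> carrier (free_sections i U)" for \<phi>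
    using res_free_closed[OF U V that] .
  have minus: "?r (\<phi> \<ominus>\<^bsub>free_sections i U\<^esub> \<psi>) = ?r \<phi> \<ominus>\<^bsub>free_sections i V\<^esub> ?r \<psi>"
    if "\<phi> \<in> carrier (free_sections i U)" "\<psi> \<in> carrier (free_sections i U)" for \<phi> \<psi>
  proof -
    \<comment> \<open>The two sides of a semilinear map have different scalars; subtraction is recovered from addition.\<close>
    have "(\<phi> \<ominus>\<^bsub>free_sections i U\<^esub> \<psi>) \<oplus>\<^bsub>free_sections i U\<^esub> \<psi> = \<phi>"
      using that by (simp add: LU.M.minus_eq LU.M.a_assoc LU.M.l_neg)
    hence "?r (\<phi> \<ominus>\<^bsub>free_sections i U\<^esub> \<psi>) \<oplus>\<^bsub>free_sections i V\<^esub> ?r \<psi> = ?r \<phi>"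
      using r_add[of "\<phi> \<ominus>\<^bsub>free_sections i U\<^esub> \<psi>" \<psi>] that by simp
    moreover have "?r (\<phi> \<ominus>\<^bsub>free_sections i U\<^esub> \<psi>) = (?r (\<phi> \<ominus>\<^bsub>free_sections i U\<^esub> \<psi>) \<oplus>\<^bsub>free_sections i V\<^esub> ?r \<psi>) \<ominus>\<^bsub>free_sections i V\<^esub> ?r \<psi>"
      using that closed by (simp add: LV.M.minus_eq LV.M.a_assoc LV.M.r_neg)
    ultimately show ?thesis by simp
  qed
  have K: "submodule K (function_ring \<O> U) (free_sections i U)"
  proof (rule LU.submoduleI_without_inverses)
    have "?r \<zero>\<^bsub>free_sections i U\<^esub> = ?r \<zero>\<^bsub>free_sections i U\<^esub> \<ominus>\<^bsub>free_sections i V\<^esub> ?r \<zero>\<^bsub>free_sections i U\<^esub>"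
      using minus[of "\<zero>\<^bsub>free_sections i U\<^esub>" "\<zero>\<^bsub>free_sections i U\<^esub>"] LU.M.r_neg[OF LU.M.zero_closed]
      by (simp only: LU.M.minus_eq LU.M.zero_closed)
    hence "?r \<zero>\<^bsub>free_sections i U\<^esub> = \<zero>\<^bsub>free_sections i V\<^esub>"
      using closed[of "\<zero>\<^bsub>free_sections i U\<^esub>"] by (simp add: LV.M.minus_eq LV.M.r_neg)
    thus "\<zero>\<^bsub>free_sections i U\<^esub> \<in> K"
      using submodule.axioms(1)[OF NV, THEN subgroup.one_closed] by (simp add: K_def)
  qed (auto simp: K_def r_add r_smult LV.submoduleE(4,5)[OF NV])
  have "exterior_generators (function_ring \<O> U) (sect F U) i \<subseteq> K"
  proof
    fix g assume g: "g \<in> exterior_generators (function_ring \<O> U) (sect F U) i"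
    let ?e = "free_gen (function_ring \<O> U)" and ?e' = "free_gen (function_ring \<O> V)"
    let ?\<rho> = "res F U V"
    have e: "?e l \<in> carrier (free_sections i U)" "?r (?e l) = ?e' (map ?\<rho> l)"
      if "set l \<subseteq> carrier (sect F U)" "length l = i" for l
    proof -
      have l: "l \<in> tuples i (carrier (sect F U))" using that by (simp add: tuples_iff)
      show "?e l \<in> carrier (free_sections i U)" by (rule free_gen_closed[OF cring_function_ring[OF U] l])
      show "?r (?e l) = ?e' (map ?\<rho> l)" by (rule res_free_gen[OF U V l])
    qed
    have mapc: "set (map ?\<rho> l) \<subseteq> carrier (sect F V)" if "set l \<subseteq> carrier (sect F U)" for l
      using that F.res_closed[OF U V] by auto
    have "?r g \<in> exterior_generators (function_ring \<O> V) (sect F V) i"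
      using g
    proof (cases rule: exterior_generatorsE)
      case (add us a b vs)
      hence m: "set us \<subseteq> carrier (sect F U)" "set vs \<subseteq> carrier (sect F U)" "a \<in> carrier (sect F U)"
          "b \<in> carrier (sect F U)" "Suc (length us + length vs) = i"
        by (auto simp: tuples_iff)
      have "?r g = ?e' (map ?\<rho> us @ (?\<rho> a \<oplus>\<^bsub>sect F V\<^esub> ?\<rho> b) # map ?\<rho> vs) \<ominus>\<^bsub>free_sections i V\<^esub>
          (?e' (map ?\<rho> us @ ?\<rho> a # map ?\<rho> vs) \<oplus>\<^bsub>free_sections i V\<^esub> ?e' (map ?\<rho> us @ ?\<rho> b # map ?\<rho> vs))"
        unfolding add(1) using m by (simp add: minus r_add e F.res_add[OF U V])
      thus ?thesis
        using m mapc F.res_closed[OF U V] by (auto simp: tuples_iff intro: exterior_generators_add)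
    next
      case (smult us f a vs)
      hence m: "set us \<subseteq> carrier (sect F U)" "set vs \<subseteq> carrier (sect F U)" "a \<in> carrier (sect F U)"
          "f \<in> carrier (function_ring \<O> U)" "Suc (length us + length vs) = i"
        by (auto simp: tuples_iff)
      have "?r g = ?e' (map ?\<rho> us @ (restrict f V \<odot>\<^bsub>sect F V\<^esub> ?\<rho> a) # map ?\<rho> vs) \<ominus>\<^bsub>free_sections i V\<^esub>
          restrict f V \<odot>\<^bsub>free_sections i V\<^esub> ?e' (map ?\<rho> us @ ?\<rho> a # map ?\<rho> vs)"
        unfolding smult(1) using m
        by (simp add: minus r_smult e F.res_smult[OF U V, folded carrier_function_ring])
      thus ?thesis
        using m mapc F.res_closed[OF U V] A.restrict_closed[OF U V]
        by (auto simp: tuples_iff carrier_function_ring intro: exterior_generators_smult)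
    next
      case (alternating us a vs ws)
      thus ?thesis
        using res_free_gen[OF U V alternating(2)] map_res_tuples[OF U V alternating(2)]
        by (auto intro: exterior_generators_alternating)
    qed
    hence "?r g \<in> ?NV" using gen by blast
    moreover have "g \<in> carrier (free_sections i U)"
      using g exterior_generators_subset[OF FU.module_axioms] by blast
    ultimately show "g \<in> K" by (simp add: K_def)
  qed
  hence "exterior_relations (function_ring \<O> U) (sect F U) i \<subseteq> K"
    unfolding exterior_relations_def using K by (rule hull_minimal)
  thus ?thesis by (auto simp: K_def)
qed

text \<open>
  Since relations restrict to relations, the exterior powers form a quotient of the presheaf of formal
  combinations.
\<close>

lemma vector_space_presheaf_exterior:
  "vector_space_presheaf X (underlying_vector_spaces (exterior_presheaf \<O> F i))"
  unfolding exterior_presheaf_def underlying_quot_presheaf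
proof (rule vector_space_presheaf_quot[OF vector_space_presheaf_free])
  show "submodule (exterior_relations (function_ring \<O> U) (sect F U) i) field_ring
      (sect (underlying_vector_spaces (free_presheaf \<O> F i)) U)" if U: "openin X U" for U
    using submodule_restrict_scalars[OF module_free_sections[OF U] cring_field_ring
        exterior_relations_submodule[OF F.module[OF U]] const_ring_hom[OF U]]
    by (simp add: underlying_vector_spaces_def free_presheaf_def)
qed (simp add: underlying_vector_spaces_def res_exterior_relations)

lemma vector_space_presheaf_exterior_sheaf: "vector_space_presheaf X (exterior_sheaf X \<O> F i)"
  unfolding exterior_sheaf_def
  by (rule vector_space_presheaf.vector_space_presheaf_sheafify[OF vector_space_presheaf_exterior])

end

section \<open>Quotients of products\<close>

lemma submodule_in_submodule:
  assumes M: "module R M" and Z: "submodule Z R M" and B: "submodule B R M" and sub: "B \<subseteq> Z"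
  shows "submodule B R (M\<lparr>carrier := Z\<rparr>)"
proof -
  interpret M: module R M by fact
  interpret MZ: module R "M\<lparr>carrier := Z\<rparr>" using submodule.submodule_is_module[OF Z M] .
  show ?thesis
    using sub submodule.axioms(1)[OF B, THEN subgroup.one_closed] M.submoduleE(4,5)[OF B]
    by (intro MZ.submoduleI_without_inverses) auto
qed

lemma submodule_prod_module:
  assumes R: "cring R" and M: "\<And>i. i \<in> I \<Longrightarrow> module R (M i)" and N: "\<And>i. i \<in> I \<Longrightarrow> submodule (N i) R (M i)"
  shows "submodule (\<Pi>\<^sub>E i\<in>I. N i) R (prod_module I M)"
proof -
  interpret P: module R "prod_module I M" using R M by (rule module_prod_module)
  have N': "N i \<subseteq> carrier (M i)" "\<zero>\<^bsub>M i\<^esub> \<in> N i" "r \<in> carrier R \<Longrightarrow> a \<in> N i \<Longrightarrow> r \<odot>\<^bsub>M i\<^esub> a \<in> N i"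
    "a \<in> N i \<Longrightarrow> b \<in> N i \<Longrightarrow> a \<oplus>\<^bsub>M i\<^esub> b \<in> N i" if "i \<in> I" for i r a b
    using module.submoduleE[OF M[OF that] N[OF that]] submodule.axioms(1)[OF N[OF that], THEN subgroup.one_closed]
    by auto
  show ?thesis
    by (rule P.submoduleI_without_inverses) (use N' in \<open>auto simp: prod_module_def PiE_iff subset_iff\<close>)
qed

text \<open>
  A coset of a product of submodules is the product of its projections, which are cosets of the
  factors. The isomorphism sends it to the family of these projections. Any element of a projection is
  reached because a single coordinate can be prescribed and the others left unchanged.
\<close>

lemma quot_prod_module_iso:
  fixes M :: "'i \<Rightarrow> ('r, 'a) module"
  assumes R: "cring R" and M: "\<And>i. i \<in> I \<Longrightarrow> module R (M i)" and N: "\<And>i. i \<in> I \<Longrightarrow> submodule (N i) R (M i)"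
  defines "\<Phi> \<equiv> \<lambda>A. \<lambda>i\<in>I. (\<lambda>a. a i) ` A"
  shows "z \<in> carrier (prod_module I M) \<Longrightarrow>
      \<Phi> ((\<Pi>\<^sub>E i\<in>I. N i) +>\<^bsub>prod_module I M\<^esub> z) = (\<lambda>i\<in>I. N i +>\<^bsub>M i\<^esub> z i)"
    and "\<Phi> \<in> module_iso R (quot_module (prod_module I M) (\<Pi>\<^sub>E i\<in>I. N i))
      (prod_module I (\<lambda>i. quot_module (M i) (N i)))"
proof -
  let ?P = "prod_module I M" and ?N = "\<Pi>\<^sub>E i\<in>I. N i" and ?Q = "prod_module I (\<lambda>i. quot_module (M i) (N i))"
  have P: "module R ?P" using R M by (rule module_prod_module)
  interpret P: module R ?P by (rule P)
  have NP: "submodule ?N R ?P" using R M N by (rule submodule_prod_module)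
  have zero: "\<zero>\<^bsub>M i\<^esub> \<in> N i" if "i \<in> I" for i
    using submodule.axioms(1)[OF N[OF that], THEN subgroup.one_closed] by simp
  have \<Phi>: "\<Phi> (?N +>\<^bsub>?P\<^esub> z) = (\<lambda>i\<in>I. N i +>\<^bsub>M i\<^esub> z i)" for z
    unfolding \<Phi>_def
  proof (rule restrict_ext)
    fix i assume i: "i \<in> I"
    show "(\<lambda>a. a i) ` (?N +>\<^bsub>?P\<^esub> z) = N i +>\<^bsub>M i\<^esub> z i"
    proof
      show "(\<lambda>a. a i) ` (?N +>\<^bsub>?P\<^esub> z) \<subseteq> N i +>\<^bsub>M i\<^esub> z i"
        using i by (auto simp: a_r_coset_def' prod_module_def)
      show "N i +>\<^bsub>M i\<^esub> z i \<subseteq> (\<lambda>a. a i) ` (?N +>\<^bsub>?P\<^esub> z)"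
      proof
        fix y assume "y \<in> N i +>\<^bsub>M i\<^esub> z i"
        then obtain n where n: "n \<in> N i" "y = n \<oplus>\<^bsub>M i\<^esub> z i" by (auto simp: a_r_coset_def')
        \<comment> \<open>an element of the product of submodules with the single coordinate \<open>n\<close> at \<open>i\<close>\<close>
        have "(\<lambda>j\<in>I. if j = i then n else \<zero>\<^bsub>M j\<^esub>) \<in> ?N" using n zero by auto
        moreover have "y = ((\<lambda>j\<in>I. if j = i then n else \<zero>\<^bsub>M j\<^esub>) \<oplus>\<^bsub>?P\<^esub> z) i"
          using i n by (simp add: prod_module_def)
        ultimately show "y \<in> (\<lambda>a. a i) ` (?N +>\<^bsub>?P\<^esub> z)" unfolding a_r_coset_def' by blast
      qed
    qed
  qed
  thus "\<Phi> (?N +>\<^bsub>?P\<^esub> z) = (\<lambda>i\<in>I. N i +>\<^bsub>M i\<^esub> z i)" .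
  have Q: "module R ?Q" by (intro module_prod_module[OF R] module_quot_module M N)
  note q = quot_map_hom[OF P NP] and qi = quot_map_hom[OF M N]
  have Pi: "z i \<in> carrier (M i)" if "z \<in> carrier ?P" "i \<in> I" for z i
    using that by (auto simp: prod_module_def)
  have comp: "(a \<oplus>\<^bsub>?P\<^esub> b) i = a i \<oplus>\<^bsub>M i\<^esub> b i" "(r \<odot>\<^bsub>?P\<^esub> a) i = r \<odot>\<^bsub>M i\<^esub> a i" if "i \<in> I" for a b r i
    using that by (simp_all add: prod_module_def)
  have "inj_on \<Phi> (carrier (quot_module ?P ?N))"
  proof (rule inj_onI)
    fix A B assume "A \<in> carrier (quot_module ?P ?N)" "B \<in> carrier (quot_module ?P ?N)" and eq: "\<Phi> A = \<Phi> B"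
    then obtain a b where a: "a \<in> carrier ?P" "A = ?N +>\<^bsub>?P\<^esub> a" and b: "b \<in> carrier ?P" "B = ?N +>\<^bsub>?P\<^esub> b"
      by (auto simp: carrier_quot_module)
    have "\<exists>n\<in>N i. a i = n \<oplus>\<^bsub>M i\<^esub> b i" if i: "i \<in> I" for i
    proof -
      interpret Mi: module R "M i" using i by (rule M)
      interpret Ni: abelian_subgroup "N i" "M i" using N[OF i] by (rule Mi.abelian_subgroup_submodule)
      have "N i +>\<^bsub>M i\<^esub> a i = N i +>\<^bsub>M i\<^esub> b i"
        using fun_cong[OF eq[unfolded a b \<Phi>], of i] i by simp
      hence "a i \<in> N i +>\<^bsub>M i\<^esub> b i" using Ni.a_rcos_self[OF Pi[OF a(1) i]] by simp
      thus ?thesis by (auto simp: a_r_coset_def')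
    qed
    then obtain n where n: "\<And>i. i \<in> I \<Longrightarrow> n i \<in> N i \<and> a i = n i \<oplus>\<^bsub>M i\<^esub> b i" by metis
    have "restrict n I \<in> ?N" using n by auto
    moreover have "a = restrict n I \<oplus>\<^bsub>?P\<^esub> b"
    proof
      show "a i = (restrict n I \<oplus>\<^bsub>?P\<^esub> b) i" for i
        using n[of i] a(1) by (cases "i \<in> I") (auto simp: prod_module_def PiE_iff extensional_def)
    qed
    ultimately have "a \<in> ?N +>\<^bsub>?P\<^esub> b" unfolding a_r_coset_def' by blast
    thus "A = B" unfolding a b by (rule P.coset_eqI[OF NP b(1)])
  qed
  moreover have "\<Phi> ` carrier (quot_module ?P ?N) = carrier ?Q"
  proof
    show "\<Phi> ` carrier (quot_module ?P ?N) \<subseteq> carrier ?Q"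
      using Pi by (auto simp: carrier_quot_module \<Phi> prod_module_def[of I "\<lambda>i. quot_module (M i) (N i)"])
    show "carrier ?Q \<subseteq> \<Phi> ` carrier (quot_module ?P ?N)"
    proof
      fix B assume B: "B \<in> carrier ?Q"
      hence "\<forall>i\<in>I. \<exists>b\<in>carrier (M i). B i = N i +>\<^bsub>M i\<^esub> b"
        by (auto simp: prod_module_def carrier_quot_module PiE_iff)
      then obtain b where b: "\<And>i. i \<in> I \<Longrightarrow> b i \<in> carrier (M i) \<and> B i = N i +>\<^bsub>M i\<^esub> b i" by metis
      have "restrict b I \<in> carrier ?P" using b by (auto simp: prod_module_def)
      moreover have "B = \<Phi> (?N +>\<^bsub>?P\<^esub> restrict b I)"
      proof
        show "B i = \<Phi> (?N +>\<^bsub>?P\<^esub> restrict b I) i" for i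
          unfolding \<Phi> using b[of i] B by (cases "i \<in> I") (auto simp: prod_module_def PiE_iff extensional_def)
      qed
      ultimately show "B \<in> \<Phi> ` carrier (quot_module ?P ?N)" unfolding carrier_quot_module by blast
    qed
  qed
  ultimately have "bij_betw \<Phi> (carrier (quot_module ?P ?N)) (carrier ?Q)" by (simp add: bij_betw_def)
  moreover have "\<Phi> (A \<oplus>\<^bsub>quot_module ?P ?N\<^esub> B) = \<Phi> A \<oplus>\<^bsub>?Q\<^esub> \<Phi> B"
    if AB: "A \<in> carrier (quot_module ?P ?N)" "B \<in> carrier (quot_module ?P ?N)" for A B
  proof -
    obtain a b where a: "a \<in> carrier ?P" "A = ?N +>\<^bsub>?P\<^esub> a" and b: "b \<in> carrier ?P" "B = ?N +>\<^bsub>?P\<^esub> b"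
      using AB by (auto simp: carrier_quot_module)
    have "N i +>\<^bsub>M i\<^esub> (a \<oplus>\<^bsub>?P\<^esub> b) i = (N i +>\<^bsub>M i\<^esub> a i) \<oplus>\<^bsub>quot_module (M i) (N i)\<^esub> (N i +>\<^bsub>M i\<^esub> b i)"
      if i: "i \<in> I" for i
      using module_hom_add[OF qi[OF i i] Pi[OF a(1) i] Pi[OF b(1) i]] i by (simp add: comp)
    thus ?thesis
      unfolding a(2) b(2) module_hom_add[OF q a(1) b(1), symmetric] \<Phi>
      by (simp add: prod_module_def[of I "\<lambda>i. quot_module (M i) (N i)"] cong: restrict_cong)
  qed
  moreover have "\<Phi> (r \<odot>\<^bsub>quot_module ?P ?N\<^esub> A) = r \<odot>\<^bsub>?Q\<^esub> \<Phi> A"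
    if r: "r \<in> carrier R" and A: "A \<in> carrier (quot_module ?P ?N)" for r A
  proof -
    obtain a where a: "a \<in> carrier ?P" "A = ?N +>\<^bsub>?P\<^esub> a"
      using A by (auto simp: carrier_quot_module)
    have "N i +>\<^bsub>M i\<^esub> (r \<odot>\<^bsub>?P\<^esub> a) i = r \<odot>\<^bsub>quot_module (M i) (N i)\<^esub> (N i +>\<^bsub>M i\<^esub> a i)"
      if i: "i \<in> I" for i
      using module_hom_smult[OF qi[OF i i] r Pi[OF a(1) i]] i by (simp add: comp)
    thus ?thesis
      unfolding a(2) module_hom_smult[OF q r a(1), symmetric] \<Phi>
      by (simp add: prod_module_def[of I "\<lambda>i. quot_module (M i) (N i)"] cong: restrict_cong)
  qed
  ultimately show "\<Phi> \<in> module_iso R (quot_module ?P ?N) ?Q"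
    using module_quot_module[OF P NP] Q by (simp add: module_iso_def)
qed

section \<open>The total complex for the zero differential\<close>

lemma antidiagonal_iff: "(i, j) \<in> antidiagonal k \<longleftrightarrow> i + j = k"
  by (simp add: antidiagonal_def)

text \<open>
  A graded presheaf stands for the complex with these terms and with zero differential; the
  hypercohomology of any such complex splits.
\<close>

locale graded_presheaf =
  fixes X :: "'x topology" and F :: "nat \<Rightarrow> ('x, 'k::field, 'a) presheaf"
  assumes presheaf: "\<And>i. vector_space_presheaf X (F i)"
begin

abbreviation "C i j \<equiv> sect (resolution X (F i) j) (topspace X)"
abbreviation "d i j \<equiv> resolution_diff X (F i) j (topspace X)"
abbreviation "Z i j \<equiv> sheaf_cocycles X (F i) j"
abbreviation "B i j \<equiv> coboundaries (C i) (d i) j"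

lemma module_C: "module field_ring (C i j)"
  by (intro vector_space_presheaf.module_resolution[OF presheaf]) simp

lemma d_hom: "d i j \<in> module_hom field_ring (C i j) (C i (Suc j))"
  by (intro vector_space_presheaf.resolution_diff_hom[OF presheaf]) simp

lemma Z_eq: "Z i j = {z \<in> carrier (C i j). d i j z = \<zero>\<^bsub>C i (Suc j)\<^esub>}"
  by (simp add: sheaf_cocycles_def cocycles_def)

lemma submodule_Z: "submodule (Z i j) field_ring (C i j)"
  unfolding Z_eq by (intro kernel_submodule module_C d_hom)

lemma submodule_B: "submodule (B i j) field_ring (C i j)"
  using image_submodule[OF module_C module_C d_hom] module.zero_submodule[OF module_C]
  by (cases j) (auto simp: coboundaries_def)

lemma B_subset_Z: "B i j \<subseteq> Z i j"
proof (cases j)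
  case 0
  show ?thesis
    using submodule.axioms(1)[OF submodule_Z[of i 0], THEN subgroup.one_closed]
    by (simp add: 0 coboundaries_def)
next
  case (Suc m)
  thus ?thesis
    using module_hom_closed[OF d_hom]
    by (auto simp: coboundaries_def Z_eq vector_space_presheaf.resolution_diff_diff[OF presheaf])
qed

lemma total_sectionsD:
  "c \<in> carrier (total_sections X F k) \<Longrightarrow> i + j = k \<Longrightarrow> c (i, j) \<in> carrier (C i j)"
  by (auto simp: total_sections_def prod_module_def PiE_iff antidiagonal_def)

text \<open>
  The horizontal part of the total differential is induced by the zero differential. What remains is the
  vertical part, up to the sign \<open>(-1)\<^sup>i\<close>.
\<close>

lemma horizontal_zero:
  assumes "c \<in> carrier (total_sections X F k)" "i + j = Suc k"
  shows "(case i of 0 \<Rightarrow> \<zero>\<^bsub>C i j\<^esub> | Suc i' \<Rightarrow>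
    resolution_map X (F i') (F i) (zero_diff F i') j (topspace X) (c (i', j))) = \<zero>\<^bsub>C i j\<^esub>"
proof (cases i)
  case (Suc i')
  thus ?thesis
    using total_sectionsD[OF assms(1), of i' j] assms(2)
    by (auto simp: zero_diff_def intro!: resolution_map_zero[OF presheaf presheaf])
qed simp

lemma total_diff_0:
  assumes c: "c \<in> carrier (total_sections X F k)"
  shows "total_diff X F (zero_diff F) k c (Suc k, 0) = \<zero>\<^bsub>C (Suc k) 0\<^esub>"
proof -
  interpret C: module field_ring "C (Suc k) 0" by (rule module_C)
  have "\<ominus>\<^bsub>C (Suc k) 0\<^esub> \<zero>\<^bsub>C (Suc k) 0\<^esub> = \<zero>\<^bsub>C (Suc k) 0\<^esub>"
    by (metis C.M.r_neg C.M.l_zero C.M.a_inv_closed C.M.zero_closed)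
  thus ?thesis
    using horizontal_zero[OF c, of "Suc k" 0]
    by (simp add: total_diff_def Let_def antidiagonal_iff)
qed

lemma total_diff_Suc:
  assumes "c \<in> carrier (total_sections X F k)" "i + j = k"
  shows "total_diff X F (zero_diff F) k c (i, Suc j)
    = (if even i then d i j (c (i, j)) else \<ominus>\<^bsub>C i (Suc j)\<^esub> d i j (c (i, j)))"
proof -
  interpret C: module field_ring "C i (Suc j)" by (rule module_C)
  have "d i j (c (i, j)) \<in> carrier (C i (Suc j))"
    by (rule module_hom_closed[OF d_hom total_sectionsD[OF assms]])
  thus ?thesis
    using horizontal_zero[OF assms(1), of i "Suc j"] assms(2)
    by (simp add: total_diff_def Let_def antidiagonal_iff)
qed

lemma total_diff_extensional: "total_diff X F D k c \<in> extensional (antidiagonal (Suc k))"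
  by (simp add: total_diff_def)

text \<open>
  The component of the total differential of \<open>c\<close> at \<open>(i, j + 1)\<close> is \<open>\<plusminus> d i j (c (i, j))\<close>, and the one at
  \<open>(k + 1, 0)\<close> vanishes. A sign does not affect the kernel.
\<close>

lemma hyper_cocycles_eq:
  "hyper_cocycles X F (zero_diff F) k = (\<Pi>\<^sub>E (i, j)\<in>antidiagonal k. Z i j)"
proof -
  have "total_diff X F (zero_diff F) k c = \<zero>\<^bsub>total_sections X F (Suc k)\<^esub>
      \<longleftrightarrow> (\<forall>i j. i + j = k \<longrightarrow> d i j (c (i, j)) = \<zero>\<^bsub>C i (Suc j)\<^esub>)" (is "?l \<longleftrightarrow> ?r")
    if c: "c \<in> carrier (total_sections X F k)" for c
  proof
    have zero: "\<zero>\<^bsub>total_sections X F (Suc k)\<^esub> (i, j) = \<zero>\<^bsub>C i j\<^esub>" if "i + j = Suc k" for i j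
      using that by (simp add: total_sections_def prod_module_def antidiagonal_iff)
    have neg: "\<ominus>\<^bsub>C i (Suc j)\<^esub> x = \<zero>\<^bsub>C i (Suc j)\<^esub> \<longleftrightarrow> x = \<zero>\<^bsub>C i (Suc j)\<^esub>" if "x \<in> carrier (C i (Suc j))" for i j x
    proof -
      interpret C: module field_ring "C i (Suc j)" by (rule module_C)
      show ?thesis using that by (metis C.M.r_neg C.M.r_zero C.M.l_zero C.M.a_inv_closed C.M.zero_closed)
    qed
    show ?r if ?l
    proof (intro allI impI)
      fix i j assume ij: "i + j = k"
      have "total_diff X F (zero_diff F) k c (i, Suc j) = \<zero>\<^bsub>C i (Suc j)\<^esub>"
        using that zero[of i "Suc j"] ij by simp
      thus "d i j (c (i, j)) = \<zero>\<^bsub>C i (Suc j)\<^esub>"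
        using total_diff_Suc[OF c ij] neg[OF module_hom_closed[OF d_hom total_sectionsD[OF c ij]]]
        by (auto split: if_splits)
    qed
    show ?l if ?r
    proof
      fix p :: "nat \<times> nat"
      obtain i j where p: "p = (i, j)" by fastforce
      show "total_diff X F (zero_diff F) k c p = \<zero>\<^bsub>total_sections X F (Suc k)\<^esub> p"
      proof (cases "i + j = Suc k")
        case True
        show ?thesis
        proof (cases j)
          case 0
          thus ?thesis using True total_diff_0[OF c] by (simp add: p zero)
        next
          case (Suc j')
          hence ij: "i + j' = k" using True by simp
          show ?thesis
            using total_diff_Suc[OF c ij] \<open>?r\<close> ij True Suc
              neg[OF module_hom_closed[OF d_hom total_sectionsD[OF c ij]]]
            by (simp add: p zero)
        qed
      next
        case False
        thus ?thesis
          using total_diff_extensional by (simp add: p total_sections_def prod_module_def total_diff_def antidiagonal_iff)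
      qed
    qed
  qed
  hence "hyper_cocycles X F (zero_diff F) k = {c \<in> carrier (total_sections X F k).
      \<forall>i j. i + j = k \<longrightarrow> d i j (c (i, j)) = \<zero>\<^bsub>C i (Suc j)\<^esub>}"
    by (auto simp: hyper_cocycles_def cocycles_def)
  also have "\<dots> = (\<Pi>\<^sub>E (i, j)\<in>antidiagonal k. Z i j)"
    by (auto simp: Z_eq total_sections_def prod_module_def PiE_iff antidiagonal_def extensional_def)
  finally show ?thesis .
qed

text \<open>
  A sign does not affect the image either: the vertical differential is applied to each component
  independently, and its image is closed under negation. In total degree zero both sides are
  trivial.
\<close>

lemma hyper_coboundaries_eq:
  "coboundaries (total_sections X F) (total_diff X F (zero_diff F)) k
    = (\<Pi>\<^sub>E (i, j)\<in>antidiagonal k. B i j)"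
proof (cases k)
  case 0
  have "(\<Pi>\<^sub>E p\<in>antidiagonal 0. case p of (i, j) \<Rightarrow> B i j)
      = {\<lambda>p\<in>antidiagonal 0. case p of (i, j) \<Rightarrow> \<zero>\<^bsub>C i j\<^esub>}"
    unfolding PiE_eq_singleton by (auto simp: antidiagonal_def coboundaries_def)
  moreover have "\<zero>\<^bsub>total_sections X F 0\<^esub> = (\<lambda>p\<in>antidiagonal 0. case p of (i, j) \<Rightarrow> \<zero>\<^bsub>C i j\<^esub>)"
    by (auto simp: total_sections_def prod_module_def split_beta intro!: restrict_ext)
  ultimately show ?thesis by (simp add: 0 coboundaries_def)
next
  case (Suc m)
  have B: "B i (Suc j) = d i j ` carrier (C i j)" "B i 0 = {\<zero>\<^bsub>C i 0\<^esub>}" for i j by (simp_all add: coboundaries_def)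
  have neg: "\<ominus>\<^bsub>C i j\<^esub> x \<in> B i j" if "x \<in> B i j" for i j x
    using module.submoduleE(3)[OF module_C submodule_B that] .
  have "total_diff X F (zero_diff F) m ` carrier (total_sections X F m) = (\<Pi>\<^sub>E (i, j)\<in>antidiagonal (Suc m). B i j)"
  proof
    show "total_diff X F (zero_diff F) m ` carrier (total_sections X F m) \<subseteq> (\<Pi>\<^sub>E (i, j)\<in>antidiagonal (Suc m). B i j)"
    proof (rule image_subsetI)
      fix c assume c: "c \<in> carrier (total_sections X F m)"
      have "total_diff X F (zero_diff F) m c (i, j) \<in> B i j" if ij: "i + j = Suc m" for i j
      proof (cases j)
        case 0
        thus ?thesis using total_diff_0[OF c] ij by (simp add: B)
      next
        case (Suc j')
        hence ij': "i + j' = m" using ij by simp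
        have "d i j' (c (i, j')) \<in> B i (Suc j')" using total_sectionsD[OF c ij'] by (simp add: B)
        thus ?thesis using total_diff_Suc[OF c ij'] neg Suc by simp
      qed
      thus "total_diff X F (zero_diff F) m c \<in> (\<Pi>\<^sub>E (i, j)\<in>antidiagonal (Suc m). B i j)"
        using total_diff_extensional by (auto simp: PiE_iff antidiagonal_iff)
    qed
    show "(\<Pi>\<^sub>E (i, j)\<in>antidiagonal (Suc m). B i j) \<subseteq> total_diff X F (zero_diff F) m ` carrier (total_sections X F m)"
    proof
      fix y assume y: "y \<in> (\<Pi>\<^sub>E (i, j)\<in>antidiagonal (Suc m). B i j)"
      hence yB: "y (i, j) \<in> B i j" if "i + j = Suc m" for i j
        using that by (auto simp: PiE_iff antidiagonal_iff)
      have "\<exists>c\<in>carrier (C i j). d i j c = (if even i then y (i, Suc j) else \<ominus>\<^bsub>C i (Suc j)\<^esub> y (i, Suc j))"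
        if "i + j = m" for i j
      proof -
        have "(if even i then y (i, Suc j) else \<ominus>\<^bsub>C i (Suc j)\<^esub> y (i, Suc j)) \<in> B i (Suc j)"
          using yB[of i "Suc j"] neg that by simp
        \<comment> \<open>The sign is put into the preimage, so that the total differential returns \<open>y\<close> itself.\<close>
        then obtain x where "(if even i then y (i, Suc j) else \<ominus>\<^bsub>C i (Suc j)\<^esub> y (i, Suc j)) = d i j x"
          "x \<in> carrier (C i j)" unfolding B(1) by (rule imageE)
        thus ?thesis by (metis (no_types))
      qed
      hence "\<forall>i j. \<exists>c. i + j = m \<longrightarrow> c \<in> carrier (C i j) \<and>
          d i j c = (if even i then y (i, Suc j) else \<ominus>\<^bsub>C i (Suc j)\<^esub> y (i, Suc j))" by blast
      then obtain c where c: "\<And>i j. i + j = m \<Longrightarrow> c i j \<in> carrier (C i j) \<and>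
          d i j (c i j) = (if even i then y (i, Suc j) else \<ominus>\<^bsub>C i (Suc j)\<^esub> y (i, Suc j))" by metis
      let ?c = "\<lambda>(i, j)\<in>antidiagonal m. c i j"
      have car: "?c \<in> carrier (total_sections X F m)"
        using c by (auto simp: total_sections_def prod_module_def antidiagonal_iff)
      have "y = total_diff X F (zero_diff F) m ?c"
      proof
        fix p :: "nat \<times> nat"
        obtain i j where p: "p = (i, j)" by fastforce
        show "y p = total_diff X F (zero_diff F) m ?c p"
        proof (cases "i + j = Suc m")
          case True
          show ?thesis
          proof (cases j)
            case 0
            thus ?thesis using True total_diff_0[OF car] yB[of i 0] by (simp add: p B)
          next
            case (Suc j')
            hence ij: "i + j' = m" using True by simp
            interpret C: module field_ring "C i (Suc j')" by (rule module_C)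
            have "y (i, Suc j') \<in> carrier (C i (Suc j'))"
              using yB[of i "Suc j'"] module.submoduleE(1)[OF module_C submodule_B] ij by auto
            thus ?thesis
              using total_diff_Suc[OF car ij] c[OF ij] ij by (simp add: p Suc antidiagonal_iff)
          qed
        next
          case False
          thus ?thesis
            using y by (simp add: p total_diff_def antidiagonal_iff PiE_iff extensional_def)
        qed
      qed
      thus "y \<in> total_diff X F (zero_diff F) m ` carrier (total_sections X F m)" using car by blast
    qed
  qed
  thus ?thesis by (simp add: Suc coboundaries_def)
qed

text \<open>
  With cocycles and coboundaries both decomposed into products over \<open>i + j = k\<close>, the hypercohomology is
  a quotient of a product by a product.
\<close>

theorem hypercohomology_zero_diff:
  "\<exists>\<Phi> \<in> module_iso field_ring (hypercohomology X F (zero_diff F) k)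
      (prod_module (antidiagonal k) (\<lambda>(i, j). sheaf_cohomology X (F i) j)).
    \<forall>z \<in> (\<Pi>\<^sub>E (i, j)\<in>antidiagonal k. Z i j).
      z \<in> hyper_cocycles X F (zero_diff F) k \<and>
      \<Phi> (hyper_class X F (zero_diff F) k z) = (\<lambda>(i, j)\<in>antidiagonal k. sheaf_class X (F i) j (z (i, j)))"
proof -
  let ?I = "antidiagonal k"
  let ?M = "\<lambda>(i, j). (C i j)\<lparr>carrier := Z i j\<rparr>" and ?N = "\<lambda>(i, j). B i j"
  let ?\<Phi> = "\<lambda>A. \<lambda>p\<in>?I. (\<lambda>a. a p) ` A"
  have M: "module field_ring (?M p)" and N: "submodule (?N p) field_ring (?M p)" for p
    using submodule.submodule_is_module[OF submodule_Z module_C]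
      submodule_in_submodule[OF module_C submodule_Z submodule_B B_subset_Z]
    by (auto split: prod.split)
  note iso = quot_prod_module_iso[where I = ?I and M = ?M and N = ?N, OF cring_field_ring M N]
  have prod: "(total_sections X F k)\<lparr>carrier := hyper_cocycles X F (zero_diff F) k\<rparr> = prod_module ?I ?M"
    unfolding hyper_cocycles_eq by (simp add: total_sections_def prod_module_def case_prod_unfold)
  have hyper: "hypercohomology X F (zero_diff F) k = quot_module (prod_module ?I ?M) (\<Pi>\<^sub>E p\<in>?I. ?N p)"
    unfolding hypercohomology_def cohomology_def hyper_coboundaries_eq
      hyper_cocycles_def[symmetric] prod ..
  have coh: "(\<lambda>p. quot_module (?M p) (?N p)) = (\<lambda>(i, j). sheaf_cohomology X (F i) j)"
    by (simp add: sheaf_cohomology_def cohomology_def sheaf_cocycles_def fun_eq_iff)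
  have "?\<Phi> (hyper_class X F (zero_diff F) k z) = (\<lambda>(i, j)\<in>?I. sheaf_class X (F i) j (z (i, j)))"
    if z: "z \<in> hyper_cocycles X F (zero_diff F) k" for z
  proof -
    have "z \<in> carrier (prod_module ?I ?M)"
      unfolding prod[symmetric] using z by simp
    note iso(1)[OF this]
    moreover have "hyper_class X F (zero_diff F) k z = (\<Pi>\<^sub>E p\<in>?I. ?N p) +>\<^bsub>prod_module ?I ?M\<^esub> z"
      unfolding hyper_class_def cohomology_class_def hyper_coboundaries_eq prod[symmetric]
        coset_carrier_update ..
    moreover have "(\<lambda>p\<in>?I. ?N p +>\<^bsub>?M p\<^esub> z p) = (\<lambda>(i, j)\<in>?I. sheaf_class X (F i) j (z (i, j)))"
      by (auto simp: sheaf_class_def cohomology_class_def coset_carrier_update intro!: restrict_ext)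
    ultimately show ?thesis by simp
  qed
  moreover have "?\<Phi> \<in> module_iso field_ring (hypercohomology X F (zero_diff F) k)
      (prod_module ?I (\<lambda>(i, j). sheaf_cohomology X (F i) j))"
    using iso(2) unfolding hyper[symmetric] coh .
  ultimately show ?thesis
    unfolding hyper_cocycles_eq[symmetric] by (intro bexI[of _ ?\<Phi>] ballI conjI)
qed

end

section \<open>Hypercohomology of the exterior algebra\<close>

theorem lemma5p4:
  fixes X :: "'x topology" and T :: "'k::field_char_0 topology"
    and \<O> :: "'x set \<Rightarrow> ('x \<Rightarrow> 'k) set"
    and F :: "('x, 'x \<Rightarrow> 'k, 'a) presheaf"
    and k :: nat
  assumes "a_space X T \<O>"
    and "sheaf_of_modules X \<O> F"
  defines "\<Lambda> \<equiv> exterior_sheaf X \<O> F"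
  shows "\<exists>\<Phi> \<in> module_iso field_ring
            (hypercohomology X \<Lambda> (zero_diff \<Lambda>) k)
            (prod_module (antidiagonal k) (\<lambda>(i, j). sheaf_cohomology X (\<Lambda> i) j)).
           \<forall>z \<in> (\<Pi>\<^sub>E (i, j)\<in>antidiagonal k. sheaf_cocycles X (\<Lambda> i) j).
             z \<in> hyper_cocycles X \<Lambda> (zero_diff \<Lambda>) k \<and>
             \<Phi> (hyper_class X \<Lambda> (zero_diff \<Lambda>) k z) =
               (\<lambda>(i, j)\<in>antidiagonal k. sheaf_class X (\<Lambda> i) j (z (i, j)))"
proof -
  interpret a_space_module X T \<O> F
    using assms(1,2) by (rule a_space_module.intro)
  interpret graded_presheaf X \<Lambda>
    unfolding \<Lambda>_def by (intro graded_presheaf.intro vector_space_presheaf_exterior_sheaf)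
  show ?thesis by (rule hypercohomology_zero_diff)
qed

end
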